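(* The space $ces_\infty$ contains a complemented subspace isomorphic to $L_1[0,1]$.
   Context: $ces_\infty$ is the space of real sequences $a=(a_n)_{n\ge1}$ with $\|a\|=\sup_{n\ge1}\frac1n\sum_{k=1}^n|a_k|<\infty$. *)

theory Defs
  imports "HOL-Analysis.Analysis"
begin

text \<open>Real sequences are functions nat => real; index k corresponds to a_(k+1).\<close>

definition ces_avg :: "(nat \<Rightarrow> real) \<Rightarrow> nat \<Rightarrow> real" where
  "ces_avg a n = (\<Sum>k\<le>n. \<bar>a k\<bar>) / real (Suc n)"

definition ces_inf :: "(nat \<Rightarrow> real) set" where
  "ces_inf = {a. bdd_above (range (ces_avg a))}"

definition ces_norm :: "(nat \<Rightarrow> real) \<Rightarrow> real" where
  "ces_norm a = (SUP n. ces_avg a n)"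

text \<open>L_1[0,1]: Lebesgue integrable real functions on [0,1], with the L1 seminorm
  (the space L_1[0,1] is the quotient modulo a.e. equality).\<close>

definition L1_01 :: "(real \<Rightarrow> real) set" where
  "L1_01 = {f. set_integrable lebesgue {0..1} f}"

definition L1_norm :: "(real \<Rightarrow> real) \<Rightarrow> real" where
  "L1_norm f = (LINT x:{0..1}|lebesgue. \<bar>f x\<bar>)"

end

theory Submission
  imports Defs "HOL-Library.Discrete_Functions"
begin

text \<open>Read a sequence as a function on the nodes of the binary tree, stored in heap order. Up to a
  factor 2 the norm of \<open>ces\<^sub>\<infinity>\<close> is the supremum over the levels of the tree of the mean absolute
  value. The embedding sends \<open>f\<close> to its averages over the dyadic intervals. Its range consists of
  dyadic martingales, the sequences in which every node carries the mean of its two children.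

  Conversely, averaging a sequence over the descendants of a node at level \<open>N\<close> and passing to the
  limit along an ultrafilter in \<open>N\<close> gives a linear projection onto the bounded dyadic martingales.
  These converge in \<open>L\<^bsub>1/2\<^esub>\<close>: for \<open>\<phi> x = sqrt (1 + x\<^sup>2)\<close> the expectations of \<open>\<phi>\<close> increase and are
  bounded, and their increments are the expectations of the Bregman distance of \<open>\<phi>\<close>, which controls
  \<open>sqrt \<bar>y - x\<bar>\<close>. The limit is integrable by Fatou's lemma, depends linearly on the martingale, and
  is \<open>f\<close> for the martingale of the averages of \<open>f\<close>. Composing with the embedding gives the
  projection.\<close>

section \<open>Limits along ultrafilters\<close>

definition ultrafilter :: "'a filter \<Rightarrow> bool" where
  "ultrafilter U \<longleftrightarrow> U \<noteq> bot \<and> (\<forall>P. eventually P U \<or> eventually (\<lambda>x. \<not> P x) U)"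

lemma minimal_filter_imp_ultrafilter:
  assumes "U \<noteq> bot" and minimal: "\<And>G. G \<le> U \<Longrightarrow> G \<noteq> bot \<Longrightarrow> G = U"
  shows "ultrafilter U"
  unfolding ultrafilter_def
proof (intro conjI allI disjCI)
  fix P assume "\<not> eventually (\<lambda>x. \<not> P x) U"
  then have "inf U (principal {x. P x}) \<noteq> bot"
    by (simp add: trivial_limit_def eventually_inf_principal)
  then have "inf U (principal {x. P x}) = U"
    by (intro minimal) auto
  then have "U \<le> principal {x. P x}"
    by (metis inf_le2)
  then show "eventually P U" by (simp add: le_principal)
qed (rule assms)

lemma Inf_filter_chain_neq_bot:
  assumes "C \<noteq> {}" "bot \<notin> C" and chain: "\<And>G H. G \<in> C \<Longrightarrow> H \<in> C \<Longrightarrow> G \<le> H \<or> H \<le> G"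
  shows "Inf C \<noteq> (bot :: 'a filter)"
proof -
  have "\<not> eventually (\<lambda>x. False) (Inf C)"
  proof (subst eventually_Inf_base[OF assms(1)])
    show "\<exists>F\<in>C. F \<le> inf G H" if "G \<in> C" "H \<in> C" for G H
      using chain[OF that] that by auto
    show "\<not> (\<exists>F\<in>C. eventually (\<lambda>x. False) F)"
      using assms(2) by (auto simp: trivial_limit_def[symmetric])
  qed
  then show ?thesis by (simp add: trivial_limit_def)
qed

lemma ultrafilter_exists_le:
  fixes F :: "'a filter"
  assumes "F \<noteq> bot"
  shows "\<exists>U\<le>F. ultrafilter U"
proof -
  let ?A = "{G. G \<le> F \<and> G \<noteq> bot}"
  have "\<exists>U\<in>?A. \<forall>G\<in>?A. G \<le> U \<longrightarrow> G = U"
  proof (rule predicate_Zorn[where P = "\<lambda>G H. H \<le> G"])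
    show "partial_order_on ?A (relation_of (\<lambda>G H. H \<le> G) ?A)"
      by (auto simp: partial_order_on_def preorder_on_def refl_on_def trans_def antisym_def
          relation_of_def)
  next
    fix C assume "C \<in> Chains (relation_of (\<lambda>G H. H \<le> G) ?A)"
    then have subset: "C \<subseteq> ?A" and chain: "\<And>G H. G \<in> C \<Longrightarrow> H \<in> C \<Longrightarrow> G \<le> H \<or> H \<le> G"
      by (auto simp: Chains_def relation_of_def)
    show "\<exists>L\<in>?A. \<forall>G\<in>C. L \<le> G"
    proof (cases "C = {}")
      case True
      then show ?thesis using assms by auto
    next
      case False
      then have "Inf C \<noteq> bot"
        using subset chain by (intro Inf_filter_chain_neq_bot) auto
      moreover have "Inf C \<le> F"
        using False subset by (auto intro: Inf_lower2)
      ultimately show ?thesis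
        by (auto intro!: bexI[of _ "Inf C"] Inf_lower)
    qed
  qed
  then obtain U where "U \<le> F" "U \<noteq> bot" "\<And>G. G \<le> U \<Longrightarrow> G \<noteq> bot \<Longrightarrow> G = U"
    by (blast intro: order_trans)
  then show ?thesis
    using minimal_filter_imp_ultrafilter by blast
qed

lemma ultrafilter_filtermap:
  assumes "ultrafilter U"
  shows "ultrafilter (filtermap f U)"
  using assms by (auto simp: ultrafilter_def filtermap_bot_iff eventually_filtermap)

lemma ultrafilter_tendsto_compact:
  fixes u :: "'a \<Rightarrow> 'b :: topological_space"
  assumes "ultrafilter U" "compact K" "eventually (\<lambda>x. u x \<in> K) U"
  shows "\<exists>l\<in>K. (u \<longlongrightarrow> l) U"
proof -
  have image: "ultrafilter (filtermap u U)"
    using assms(1) by (rule ultrafilter_filtermap)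
  moreover have "eventually (\<lambda>y. y \<in> K) (filtermap u U)"
    using assms(3) by (simp add: eventually_filtermap)
  ultimately obtain l where "l \<in> K" and adherent: "inf (nhds l) (filtermap u U) \<noteq> bot"
    using assms(2) unfolding compact_filter ultrafilter_def by blast
  have "(u \<longlongrightarrow> l) U"
  proof (rule topological_tendstoI, rule ccontr)
    fix S assume S: "open S" "l \<in> S" and "\<not> eventually (\<lambda>x. u x \<in> S) U"
    then have "eventually (\<lambda>y. y \<notin> S) (filtermap u U)"
      using assms(1) by (auto simp: ultrafilter_def eventually_filtermap)
    moreover have "eventually (\<lambda>y. y \<in> S) (nhds l)"
      using S by (rule eventually_nhds_in_open)
    ultimately have "eventually (\<lambda>y. False) (inf (nhds l) (filtermap u U))"
      unfolding eventually_inf by blast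
    with adherent show False by (simp add: trivial_limit_def)
  qed
  with \<open>l \<in> K\<close> show ?thesis by blast
qed

definition free_ultrafilter :: "nat filter" where
  "free_ultrafilter = (SOME U. U \<le> sequentially \<and> ultrafilter U)"

definition ultralim :: "(nat \<Rightarrow> real) \<Rightarrow> real" where
  "ultralim u = Lim free_ultrafilter u"

lemma
  shows free_ultrafilter_le: "free_ultrafilter \<le> sequentially"
    and ultrafilter_free_ultrafilter: "ultrafilter free_ultrafilter"
    and free_ultrafilter_neq_bot: "free_ultrafilter \<noteq> bot"
proof -
  have "\<exists>U. U \<le> sequentially \<and> ultrafilter U"
    using ultrafilter_exists_le[OF sequentially_bot] by blast
  from someI_ex[OF this]
  show "free_ultrafilter \<le> sequentially" and "ultrafilter free_ultrafilter"
    unfolding free_ultrafilter_def by blast+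
  then show "free_ultrafilter \<noteq> bot"
    by (simp add: ultrafilter_def)
qed

lemma eventually_free_ultrafilter:
  "eventually P sequentially \<Longrightarrow> eventually P free_ultrafilter"
  using free_ultrafilter_le by (rule filter_leD)

lemma ultralim_eqI:
  "(u \<longlongrightarrow> l) free_ultrafilter \<Longrightarrow> ultralim u = l"
  unfolding ultralim_def using free_ultrafilter_neq_bot by (rule tendsto_Lim)

lemma tendsto_ultralim:
  assumes "eventually (\<lambda>n. \<bar>u n\<bar> \<le> B) sequentially"
  shows "(u \<longlongrightarrow> ultralim u) free_ultrafilter"
proof -
  have "eventually (\<lambda>n. u n \<in> {-B..B}) free_ultrafilter"
    using eventually_free_ultrafilter[OF assms] by eventually_elim auto
  then obtain l where "(u \<longlongrightarrow> l) free_ultrafilter"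
    using ultrafilter_tendsto_compact[OF ultrafilter_free_ultrafilter compact_Icc] by blast
  then show ?thesis using ultralim_eqI by blast
qed

section \<open>A strictly convex function of linear growth\<close>

definition soft_abs :: "real \<Rightarrow> real" where
  "soft_abs x = sqrt (1 + x\<^sup>2)"

lemma soft_abs_measurable [measurable]: "soft_abs \<in> borel_measurable borel"
  unfolding soft_abs_def by measurable

lemma soft_abs_ge_1: "1 \<le> soft_abs x"
  by (simp add: soft_abs_def)

lemma soft_abs_power2: "(soft_abs x)\<^sup>2 = 1 + x\<^sup>2"
  by (simp add: soft_abs_def)

lemma abs_le_soft_abs: "\<bar>x\<bar> \<le> soft_abs x"
  unfolding soft_abs_def by (rule real_le_rsqrt) simp

lemma soft_abs_le: "soft_abs x \<le> 1 + \<bar>x\<bar>"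
  unfolding soft_abs_def by (rule real_le_lsqrt) (auto simp: power2_eq_square algebra_simps)

text \<open>The derivative of \<open>soft_abs\<close> at \<open>x\<close> is \<open>x / soft_abs x\<close>, so this is its Bregman distance.\<close>

definition soft_abs_bregman :: "real \<Rightarrow> real \<Rightarrow> real" where
  "soft_abs_bregman y x = soft_abs y - soft_abs x - x / soft_abs x * (y - x)"

lemma soft_abs_mult_bregman:
  "soft_abs x * soft_abs_bregman y x = soft_abs x * soft_abs y - (1 + x * y)"
proof -
  have "soft_abs x * soft_abs_bregman y x = soft_abs x * soft_abs y - (soft_abs x)\<^sup>2 - x * (y - x)"
    using soft_abs_ge_1[of x] by (simp add: soft_abs_bregman_def field_simps power2_eq_square)
  then show ?thesis
    unfolding soft_abs_power2 by (simp add: power2_eq_square algebra_simps)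
qed

lemma abs_one_plus_mult_le_soft_abs: "\<bar>1 + x * y\<bar> \<le> soft_abs x * soft_abs y"
proof (rule power2_le_imp_le)
  have "(soft_abs x * soft_abs y)\<^sup>2 = (1 + x * y)\<^sup>2 + (y - x)\<^sup>2"
    unfolding power_mult_distrib soft_abs_power2 by algebra
  then show "\<bar>1 + x * y\<bar>\<^sup>2 \<le> (soft_abs x * soft_abs y)\<^sup>2" by simp
  show "0 \<le> soft_abs x * soft_abs y"
    using soft_abs_ge_1[of x] soft_abs_ge_1[of y] by simp
qed

lemma soft_abs_bregman_nonneg: "0 \<le> soft_abs_bregman y x"
proof -
  have "0 \<le> soft_abs x * soft_abs_bregman y x"
    unfolding soft_abs_mult_bregman using abs_one_plus_mult_le_soft_abs[of x y] by linarith
  then show ?thesis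
    using soft_abs_ge_1[of x] by (simp add: zero_le_mult_iff)
qed

lemma power2_diff_le_bregman:
  "(y - x)\<^sup>2 \<le> (soft_abs x + soft_abs y) ^ 3 * soft_abs_bregman y x"
proof -
  define p q where "p = soft_abs x" and "q = soft_abs y"
  have p: "1 \<le> p" "p\<^sup>2 = 1 + x\<^sup>2" and q: "1 \<le> q" "q\<^sup>2 = 1 + y\<^sup>2"
    by (simp_all add: p_def q_def soft_abs_ge_1 soft_abs_power2)
  have "(y - x)\<^sup>2 = p\<^sup>2 * q\<^sup>2 - (1 + x * y)\<^sup>2"
    unfolding p(2) q(2) by algebra
  also have "\<dots> = (p * soft_abs_bregman y x) * (p * q + (1 + x * y))"
    unfolding p_def q_def soft_abs_mult_bregman by algebra
  also have "\<dots> \<le> (p * soft_abs_bregman y x) * (2 * (p * q))"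
    using p(1) abs_one_plus_mult_le_soft_abs[of x y] soft_abs_bregman_nonneg[of y x]
    by (intro mult_left_mono) (auto simp: p_def q_def)
  also have "\<dots> = 2 * p\<^sup>2 * q * soft_abs_bregman y x"
    by (simp add: power2_eq_square)
  also have "\<dots> \<le> (p + q) ^ 3 * soft_abs_bregman y x"
  proof (rule mult_right_mono[OF _ soft_abs_bregman_nonneg])
    have "(p + q) ^ 3 = 2 * p\<^sup>2 * q + (p ^ 3 + p\<^sup>2 * q + 3 * p * q\<^sup>2 + q ^ 3)"
      by algebra
    moreover have "0 \<le> p ^ 3 + p\<^sup>2 * q + 3 * p * q\<^sup>2 + q ^ 3"
      using p(1) q(1) by simp
    ultimately show "2 * p\<^sup>2 * q \<le> (p + q) ^ 3" by linarith
  qed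
  finally show ?thesis by (simp add: p_def q_def)
qed

lemma sqrt_abs_diff_le_bregman:
  assumes "0 < t"
  shows "sqrt \<bar>y - x\<bar> \<le> t * (soft_abs x + soft_abs y) + soft_abs_bregman y x / t ^ 3"
proof -
  define u v where "u = t * (soft_abs x + soft_abs y)" and "v = soft_abs_bregman y x / t ^ 3"
  have nonneg: "0 \<le> u" "0 \<le> v"
    using assms soft_abs_ge_1[of x] soft_abs_ge_1[of y] soft_abs_bregman_nonneg[of y x]
    by (simp_all add: u_def v_def)
  have "(y - x)\<^sup>2 \<le> u ^ 3 * v"
    using power2_diff_le_bregman[of y x] assms by (simp add: u_def v_def power_mult_distrib)
  also have "\<dots> \<le> (u + v) ^ 3 * (u + v)"
    using nonneg by (intro mult_mono power_mono) auto
  also have "\<dots> = ((u + v)\<^sup>2)\<^sup>2"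
    by algebra
  finally have "\<bar>y - x\<bar> \<le> (u + v)\<^sup>2"
    by (metis abs_le_square_iff abs_power2)
  then have "sqrt \<bar>y - x\<bar> \<le> u + v"
    using nonneg by (intro real_le_lsqrt) auto
  then show ?thesis by (simp add: u_def v_def)
qed

lemma sqrt_abs_add_le: "sqrt \<bar>x + y\<bar> \<le> sqrt \<bar>x\<bar> + sqrt \<bar>y\<bar>"
proof -
  have "sqrt \<bar>x + y\<bar> \<le> sqrt (\<bar>x\<bar> + \<bar>y\<bar>)"
    by (simp add: abs_triangle_ineq)
  also have "\<dots> \<le> sqrt \<bar>x\<bar> + sqrt \<bar>y\<bar>"
    by (rule sqrt_add_le_add_sqrt) auto
  finally show ?thesis .
qed

section \<open>Convergence in \<open>L\<^bsub>1/2\<^esub>\<close>\<close>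

lemma sqrt_diff_le:
  assumes "x \<le> y"
  shows "sqrt y - sqrt x \<le> 2 * sqrt (y - x)"
proof -
  have nonneg: "0 \<le> sqrt (y - x)" using assms by simp
  consider "0 \<le> x" | "y \<le> 0" | "x < 0" "0 < y" by linarith
  then show ?thesis
  proof cases
    case 1
    then have "sqrt y \<le> sqrt x + sqrt (y - x)"
      using assms sqrt_add_le_add_sqrt[of x "y - x"] by simp
    then show ?thesis using nonneg by linarith
  next
    case 2
    then have "sqrt (- x) \<le> sqrt (- y) + sqrt (y - x)"
      using assms sqrt_add_le_add_sqrt[of "- y" "y - x"] by simp
    then show ?thesis using nonneg unfolding real_sqrt_minus by linarith
  next
    case 3
    then have "sqrt y \<le> sqrt (y - x)" "sqrt (- x) \<le> sqrt (y - x)" by simp_all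
    then show ?thesis unfolding real_sqrt_minus by linarith
  qed
qed

lemma abs_sqrt_diff_le: "\<bar>sqrt x - sqrt y\<bar> \<le> 2 * sqrt \<bar>x - y\<bar>"
  using sqrt_diff_le[of x y] sqrt_diff_le[of y x] by (cases "x \<le> y") (auto simp: abs_real_def)

text \<open>\<open>sqrt\<close> is odd, so this also covers negative values.\<close>

lemma LIMSEQ_of_LIMSEQ_sqrt:
  assumes "(\<lambda>n. sqrt (u n)) \<longlonglongrightarrow> l"
  shows "u \<longlonglongrightarrow> l * \<bar>l\<bar>"
proof -
  have "u = (\<lambda>n. sqrt (u n) * \<bar>sqrt (u n)\<bar>)"
    by (auto simp: fun_eq_iff real_sqrt_abs' [symmetric] abs_real_def real_sqrt_minus)
  also have "\<dots> \<longlonglongrightarrow> l * \<bar>l\<bar>"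
    by (intro tendsto_intros assms)
  finally show ?thesis .
qed

lemma
  fixes u :: "nat \<Rightarrow> 'a \<Rightarrow> 'b :: {banach, second_countable_topology}"
  assumes integrable: "\<And>i. integrable M (u i)" and [measurable]: "g \<in> borel_measurable M"
    and limit: "AE x in M. (\<lambda>i. u i x) \<longlonglongrightarrow> g x"
    and bound: "\<And>i. (LINT x|M. norm (u i x)) \<le> B"
  shows integrable_Fatou: "integrable M g"
    and integral_norm_le_Fatou: "(LINT x|M. norm (g x)) \<le> B"
proof -
  have [measurable]: "u i \<in> borel_measurable M" for i
    using integrable by (rule borel_measurable_integrable)
  have "0 \<le> B" by (rule order_trans[OF _ bound[of 0]]) simp
  have "(\<integral>\<^sup>+x. ennreal (norm (g x)) \<partial>M) = (\<integral>\<^sup>+x. liminf (\<lambda>i. ennreal (norm (u i x))) \<partial>M)"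
  proof (rule nn_integral_cong_AE)
    show "AE x in M. ennreal (norm (g x)) = liminf (\<lambda>i. ennreal (norm (u i x)))"
      using limit
    proof eventually_elim
      case (elim x)
      then have "(\<lambda>i. ennreal (norm (u i x))) \<longlonglongrightarrow> ennreal (norm (g x))"
        by (intro tendsto_ennrealI tendsto_norm)
      then show ?case by (intro lim_imp_Liminf[symmetric]) auto
    qed
  qed
  also have "\<dots> \<le> liminf (\<lambda>i. \<integral>\<^sup>+x. ennreal (norm (u i x)) \<partial>M)"
    by (rule nn_integral_liminf) simp
  also have "\<dots> \<le> ennreal B"
  proof (rule order_trans[OF Liminf_le_Limsup])
    have "(\<integral>\<^sup>+x. ennreal (norm (u i x)) \<partial>M) \<le> ennreal B" for i
      using integrable bound by (subst nn_integral_eq_integral) (auto intro: ennreal_leI)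
    then show "limsup (\<lambda>i. \<integral>\<^sup>+x. ennreal (norm (u i x)) \<partial>M) \<le> ennreal B"
      by (intro Limsup_bounded always_eventually) auto
  qed simp
  finally have nn_bound: "(\<integral>\<^sup>+x. ennreal (norm (g x)) \<partial>M) \<le> ennreal B" .
  then show g_integrable: "integrable M g"
    by (intro integrableI_bounded) (auto intro: le_less_trans)
  have "ennreal (LINT x|M. norm (g x)) \<le> ennreal B"
    using nn_bound g_integrable by (subst nn_integral_eq_integral[symmetric]) auto
  then show "(LINT x|M. norm (g x)) \<le> B" using \<open>0 \<le> B\<close> by simp
qed

text \<open>Meaningful only if the differences \<open>X k - g\<close> are integrable, since other integrals are \<open>0\<close>.\<close>

definition Lhalf_tendsto :: "'a measure \<Rightarrow> (nat \<Rightarrow> 'a \<Rightarrow> real) \<Rightarrow> ('a \<Rightarrow> real) \<Rightarrow> bool" where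
  "Lhalf_tendsto M X g \<longleftrightarrow> (\<lambda>k. LINT x|M. sqrt \<bar>X k x - g x\<bar>) \<longlonglongrightarrow> 0"

definition Lhalf_Cauchy :: "'a measure \<Rightarrow> (nat \<Rightarrow> 'a \<Rightarrow> real) \<Rightarrow> bool" where
  "Lhalf_Cauchy M X \<longleftrightarrow> (\<forall>e>0. \<exists>N. \<forall>i\<ge>N. \<forall>j\<ge>N. (LINT x|M. sqrt \<bar>X i x - X j x\<bar>) < e)"

lemma Lhalf_CauchyE:
  assumes "Lhalf_Cauchy M X" "0 < e"
  obtains N where "\<And>i j. N \<le> i \<Longrightarrow> N \<le> j \<Longrightarrow> (LINT x|M. sqrt \<bar>X i x - X j x\<bar>) < e"
  using assms unfolding Lhalf_Cauchy_def by blast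

context finite_measure
begin

lemma integrable_sqrt_abs:
  assumes "integrable M f"
  shows "integrable M (\<lambda>x. sqrt \<bar>f x\<bar>)"
proof (rule Bochner_Integration.integrable_bound)
  show "integrable M (\<lambda>x. 1 + \<bar>f x\<bar>)" using assms by simp
  have "sqrt \<bar>y\<bar> \<le> 1 + \<bar>y\<bar>" for y :: real
    by (rule real_le_lsqrt) (auto simp: power2_eq_square algebra_simps)
  then show "AE x in M. norm (sqrt \<bar>f x\<bar>) \<le> norm (1 + \<bar>f x\<bar>)" by simp
qed (use assms in simp)

lemma integrable_sqrt:
  assumes "integrable M f"
  shows "integrable M (\<lambda>x. sqrt (f x))"
  using integrable_sqrt_abs[OF assms]
  by (rule Bochner_Integration.integrable_bound) (use assms in \<open>auto simp: real_sqrt_abs'\<close>)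

lemma integral_abs_sqrt_diff_le:
  assumes "integrable M f" "integrable M g"
  shows "(LINT x|M. \<bar>sqrt (f x) - sqrt (g x)\<bar>) \<le> 2 * (LINT x|M. sqrt \<bar>f x - g x\<bar>)"
proof -
  have "(LINT x|M. \<bar>sqrt (f x) - sqrt (g x)\<bar>) \<le> (LINT x|M. 2 * sqrt \<bar>f x - g x\<bar>)"
    using assms
    by (intro integral_mono) (auto simp: integrable_sqrt integrable_sqrt_abs abs_sqrt_diff_le)
  then show ?thesis by simp
qed

lemma Lhalf_tendsto_linear:
  assumes integrable: "\<And>k. integrable M (X k)" "\<And>k. integrable M (Y k)"
      "integrable M g" "integrable M h"
    and limit: "Lhalf_tendsto M X g" "Lhalf_tendsto M Y h"
  shows "Lhalf_tendsto M (\<lambda>k x. \<alpha> * X k x + \<beta> * Y k x) (\<lambda>x. \<alpha> * g x + \<beta> * h x)"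
  unfolding Lhalf_tendsto_def
proof (rule tendsto_sandwich[where f = "\<lambda>_. 0", OF always_eventually always_eventually])
  let ?bound = "\<lambda>k. sqrt \<bar>\<alpha>\<bar> * (LINT x|M. sqrt \<bar>X k x - g x\<bar>)
    + sqrt \<bar>\<beta>\<bar> * (LINT x|M. sqrt \<bar>Y k x - h x\<bar>)"
  have "sqrt \<bar>(\<alpha> * X k x + \<beta> * Y k x) - (\<alpha> * g x + \<beta> * h x)\<bar>
      \<le> sqrt \<bar>\<alpha>\<bar> * sqrt \<bar>X k x - g x\<bar> + sqrt \<bar>\<beta>\<bar> * sqrt \<bar>Y k x - h x\<bar>" for k x
  proof -
    have "(\<alpha> * X k x + \<beta> * Y k x) - (\<alpha> * g x + \<beta> * h x) = \<alpha> * (X k x - g x) + \<beta> * (Y k x - h x)"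
      by (simp add: algebra_simps)
    then show ?thesis
      using sqrt_abs_add_le[of "\<alpha> * (X k x - g x)" "\<beta> * (Y k x - h x)"]
      by (simp only: abs_mult real_sqrt_mult)
  qed
  then have "(LINT x|M. sqrt \<bar>(\<alpha> * X k x + \<beta> * Y k x) - (\<alpha> * g x + \<beta> * h x)\<bar>)
      \<le> (LINT x|M. sqrt \<bar>\<alpha>\<bar> * sqrt \<bar>X k x - g x\<bar> + sqrt \<bar>\<beta>\<bar> * sqrt \<bar>Y k x - h x\<bar>)" for k
    by (intro integral_mono integrable_sqrt_abs Bochner_Integration.integrable_add
        Bochner_Integration.integrable_diff integrable_mult_right integrable)
  then show "\<forall>k. (LINT x|M. sqrt \<bar>(\<alpha> * X k x + \<beta> * Y k x) - (\<alpha> * g x + \<beta> * h x)\<bar>) \<le> ?bound k"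
    by (simp add: integrable_sqrt_abs integrable)
  show "?bound \<longlonglongrightarrow> 0"
    using tendsto_add[OF tendsto_mult_left tendsto_mult_left, OF limit[unfolded Lhalf_tendsto_def]]
    by simp
qed auto

lemma Lhalf_tendsto_unique:
  assumes integrable: "\<And>k. integrable M (X k)" "integrable M g" "integrable M h"
    and limit: "Lhalf_tendsto M X g" "Lhalf_tendsto M X h"
  shows "AE x in M. g x = h x"
proof -
  have "Lhalf_tendsto M (\<lambda>k x. 0) (\<lambda>x. g x - h x)"
    using Lhalf_tendsto_linear[OF integrable(1,1,2,3) limit, of 1 "-1"] by simp
  then have "(LINT x|M. sqrt \<bar>g x - h x\<bar>) = 0"
    by (simp add: Lhalf_tendsto_def LIMSEQ_const_iff abs_minus_commute)
  then have "AE x in M. sqrt \<bar>g x - h x\<bar> = 0"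
    by (subst (asm) integral_nonneg_eq_0_iff_AE) (auto intro!: integrable_sqrt_abs integrable)
  then show ?thesis by eventually_elim simp
qed

lemma Lhalf_tendsto_if_L1_tendsto:
  assumes integrable: "\<And>k. integrable M (X k)" "integrable M g"
    and limit: "(\<lambda>k. LINT x|M. \<bar>X k x - g x\<bar>) \<longlonglongrightarrow> 0"
  shows "Lhalf_tendsto M X g"
  unfolding Lhalf_tendsto_def
proof (rule LIMSEQ_I)
  fix e :: real assume "0 < e"
  define m where "m = measure M (space M)"
  define t where "t = e / (2 * (m + 1))"
  have "0 \<le> m" by (simp add: m_def)
  with \<open>0 < e\<close> have t_pos: "0 < t" and t_small: "t * m < e / 2" by (auto simp: t_def field_simps)
  have AM_GM: "sqrt \<bar>y\<bar> \<le> t + \<bar>y\<bar> / t" for y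
  proof (rule real_le_lsqrt)
    have "\<bar>y\<bar> \<le> t\<^sup>2 + 2 * \<bar>y\<bar> + (\<bar>y\<bar> / t)\<^sup>2" by simp
    also have "\<dots> = (t + \<bar>y\<bar> / t)\<^sup>2" using t_pos by (simp add: power2_sum)
    finally show "\<bar>y\<bar> \<le> (t + \<bar>y\<bar> / t)\<^sup>2" .
  qed (use t_pos in auto)
  obtain N where small: "\<And>k. N \<le> k \<Longrightarrow> (LINT x|M. \<bar>X k x - g x\<bar>) < t * e / 2"
    using LIMSEQ_D[OF limit, of "t * e / 2"] t_pos \<open>0 < e\<close> by auto
  have "(LINT x|M. sqrt \<bar>X k x - g x\<bar>) < e" if "N \<le> k" for k
  proof -
    have "(LINT x|M. sqrt \<bar>X k x - g x\<bar>) \<le> (LINT x|M. t + \<bar>X k x - g x\<bar> / t)"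
      by (intro integral_mono AM_GM integrable_sqrt_abs) (auto simp: integrable)
    also have "\<dots> = t * m + (LINT x|M. \<bar>X k x - g x\<bar>) / t"
      by (simp add: integrable m_def)
    also have "(LINT x|M. \<bar>X k x - g x\<bar>) / t < e / 2"
      using small[OF that] t_pos by (simp add: field_simps)
    finally show ?thesis using t_small by simp
  qed
  then show "\<exists>N. \<forall>k\<ge>N. norm ((LINT x|M. sqrt \<bar>X k x - g x\<bar>) - 0) < e"
    by auto
qed

lemma Lhalf_Cauchy_AE_convergent_subseq:
  assumes integrable: "\<And>k. integrable M (X k)" and Cauchy: "Lhalf_Cauchy M X"
  obtains r g where "strict_mono r" "g \<in> borel_measurable M" "AE x in M. (\<lambda>i. X (r i) x) \<longlonglongrightarrow> g x"
proof -
  have [measurable]: "X k \<in> borel_measurable M" for k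
    using integrable by (rule borel_measurable_integrable)
  have sqrt_Cauchy:
    "\<exists>N. \<forall>i\<ge>N. \<forall>j\<ge>N. (LINT x|M. norm (sqrt (X i x) - sqrt (X j x))) < e" if "0 < e" for e
  proof -
    obtain N where "\<And>i j. N \<le> i \<Longrightarrow> N \<le> j \<Longrightarrow> (LINT x|M. sqrt \<bar>X i x - X j x\<bar>) < e / 2"
      using Lhalf_CauchyE[OF Cauchy half_gt_zero[OF \<open>0 < e\<close>]] by blast
    then have "(LINT x|M. norm (sqrt (X i x) - sqrt (X j x))) < e" if "N \<le> i" "N \<le> j" for i j
      using integral_abs_sqrt_diff_le[OF integrable[of i] integrable[of j]] that by fastforce
    then show ?thesis by blast
  qed
  obtain r where r: "strict_mono r" "AE x in M. Cauchy (\<lambda>i. sqrt (X (r i) x))"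
    using cauchy_L1_AE_cauchy_subseq[OF integrable_sqrt[OF integrable] sqrt_Cauchy] by blast
  define g where "g x = lim (\<lambda>i. X (r i) x)" for x
  have "g \<in> borel_measurable M" unfolding g_def by measurable
  moreover have "AE x in M. (\<lambda>i. X (r i) x) \<longlonglongrightarrow> g x"
    using r(2)
  proof eventually_elim
    case (elim x)
    then obtain l where "(\<lambda>i. sqrt (X (r i) x)) \<longlonglongrightarrow> l"
      by (auto simp: Cauchy_convergent_iff convergent_def)
    from LIMSEQ_of_LIMSEQ_sqrt[OF this] show ?case
      unfolding g_def by (simp add: limI)
  qed
  ultimately show ?thesis using r(1) that by blast
qed

lemma Lhalf_Cauchy_imp_tendsto:
  assumes integrable: "\<And>k. integrable M (X k)" and bound: "\<And>k. (LINT x|M. \<bar>X k x\<bar>) \<le> B"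
    and Cauchy: "Lhalf_Cauchy M X"
  obtains g where "integrable M g" "(LINT x|M. \<bar>g x\<bar>) \<le> B" "Lhalf_tendsto M X g"
proof -
  obtain r g where r: "strict_mono r" and [measurable]: "g \<in> borel_measurable M"
    and limit: "AE x in M. (\<lambda>i. X (r i) x) \<longlonglongrightarrow> g x"
    using Lhalf_Cauchy_AE_convergent_subseq[OF integrable Cauchy] by blast
  have [measurable]: "X k \<in> borel_measurable M" for k
    using integrable by (rule borel_measurable_integrable)
  have "integrable M g" "(LINT x|M. \<bar>g x\<bar>) \<le> B"
    using integrable_Fatou[OF integrable _ limit] integral_norm_le_Fatou[OF integrable _ limit]
      bound by auto
  moreover have "Lhalf_tendsto M X g"
    unfolding Lhalf_tendsto_def
  proof (rule LIMSEQ_I)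
    fix e :: real assume "0 < e"
    obtain N where small: "\<And>i j. N \<le> i \<Longrightarrow> N \<le> j \<Longrightarrow> (LINT x|M. sqrt \<bar>X i x - X j x\<bar>) < e / 2"
      using Lhalf_CauchyE[OF Cauchy half_gt_zero[OF \<open>0 < e\<close>]] by blast
    have "(LINT x|M. norm (sqrt \<bar>X k x - g x\<bar>)) \<le> e / 2" if "N \<le> k" for k
    proof (rule integral_norm_le_Fatou)
      show "AE x in M. (\<lambda>i. sqrt \<bar>X k x - X (r (i + N)) x\<bar>) \<longlonglongrightarrow> sqrt \<bar>X k x - g x\<bar>"
        using limit
      proof eventually_elim
        case (elim x)
        from LIMSEQ_ignore_initial_segment[OF this, of N] show ?case
          by (intro tendsto_intros)
      qed
      have "N \<le> r (i + N)" for i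
        using seq_suble[OF r, of "i + N"] by linarith
      then show "(LINT x|M. norm (sqrt \<bar>X k x - X (r (i + N)) x\<bar>)) \<le> e / 2" for i
        using small[OF that] by (simp add: less_imp_le)
    qed (simp_all add: integrable integrable_sqrt_abs)
    then show "\<exists>N. \<forall>k\<ge>N. norm ((LINT x|M. sqrt \<bar>X k x - g x\<bar>) - 0) < e"
      using \<open>0 < e\<close> by (force intro!: exI[of _ N])
  qed
  ultimately show ?thesis using that by blast
qed

end

section \<open>\<open>L\<^sub>1\<close>-bounded martingales\<close>

text \<open>The conditional expectation of \<open>X l\<close> given \<open>X k\<close> is \<open>X k\<close>, which is weaker than the martingale
  property for a filtration.\<close>

definition weak_martingale :: "'a measure \<Rightarrow> (nat \<Rightarrow> 'a \<Rightarrow> real) \<Rightarrow> bool" where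
  "weak_martingale M X \<longleftrightarrow> (\<forall>k. integrable M (X k)) \<and>
    (\<forall>h\<in>borel_measurable borel. bounded (range h) \<longrightarrow>
      (\<forall>k l. k \<le> l \<longrightarrow> (LINT x|M. h (X k x) * X l x) = (LINT x|M. h (X k x) * X k x)))"

lemma weak_martingale_integrable: "weak_martingale M X \<Longrightarrow> integrable M (X k)"
  by (simp add: weak_martingale_def)

lemma weak_martingaleD:
  assumes "weak_martingale M X" "h \<in> borel_measurable borel" "bounded (range h)" "k \<le> l"
  shows "(LINT x|M. h (X k x) * X l x) = (LINT x|M. h (X k x) * X k x)"
  using assms unfolding weak_martingale_def by blast

context finite_measure
begin

lemma integrable_soft_abs:
  assumes "integrable M f"
  shows "integrable M (\<lambda>x. soft_abs (f x))"
proof (rule Bochner_Integration.integrable_bound)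
  show "integrable M (\<lambda>x. 1 + \<bar>f x\<bar>)" using assms by simp
  have "\<bar>soft_abs y\<bar> \<le> 1 + \<bar>y\<bar>" for y
    using soft_abs_ge_1[of y] soft_abs_le[of y] by linarith
  then show "AE x in M. norm (soft_abs (f x)) \<le> norm (1 + \<bar>f x\<bar>)" by simp
qed (use assms in simp)

lemma
  assumes "weak_martingale M X" "k \<le> l"
  shows integrable_bregman_martingale: "integrable M (\<lambda>x. soft_abs_bregman (X l x) (X k x))"
    and integral_bregman_martingale:
      "(LINT x|M. soft_abs_bregman (X l x) (X k x))
        = (LINT x|M. soft_abs (X l x)) - (LINT x|M. soft_abs (X k x))"
proof -
  define h where "h x = x / soft_abs x" for x
  have [measurable]: "h \<in> borel_measurable borel" unfolding h_def by measurable
  have h_bound: "\<bar>h x\<bar> \<le> 1" for x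
    using abs_le_soft_abs[of x] soft_abs_ge_1[of x] by (simp add: h_def abs_divide divide_le_eq_1)
  note integrable = weak_martingale_integrable[OF assms(1)]
  have integrable_h: "integrable M (\<lambda>x. h (X k x) * X l x)" for l
  proof (rule Bochner_Integration.integrable_bound[OF integrable[of l]])
    show "AE x in M. norm (h (X k x) * X l x) \<le> norm (X l x)"
      using h_bound by (simp add: abs_mult mult_left_le_one_le)
  qed (use integrable in measurable)
  have bregman_eq: "soft_abs_bregman (X l x) (X k x)
      = soft_abs (X l x) - soft_abs (X k x) - (h (X k x) * X l x - h (X k x) * X k x)" for x
    by (simp add: soft_abs_bregman_def h_def right_diff_distrib)
  show "integrable M (\<lambda>x. soft_abs_bregman (X l x) (X k x))"
    unfolding bregman_eq
    by (intro Bochner_Integration.integrable_diff integrable_soft_abs integrable integrable_h)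
  have "bounded (range h)"
    using h_bound by (intro boundedI[where B = 1]) auto
  then have "(LINT x|M. h (X k x) * X l x) = (LINT x|M. h (X k x) * X k x)"
    using assms by (intro weak_martingaleD) auto
  then show "(LINT x|M. soft_abs_bregman (X l x) (X k x))
      = (LINT x|M. soft_abs (X l x)) - (LINT x|M. soft_abs (X k x))"
    unfolding bregman_eq by (simp add: integrable_soft_abs integrable integrable_h)
qed

lemma integral_soft_abs_martingale_mono:
  assumes "weak_martingale M X" "k \<le> l"
  shows "(LINT x|M. soft_abs (X k x)) \<le> (LINT x|M. soft_abs (X l x))"
proof -
  have "0 \<le> (LINT x|M. soft_abs_bregman (X l x) (X k x))"
    by (simp add: soft_abs_bregman_nonneg)
  then show ?thesis
    unfolding integral_bregman_martingale[OF assms] by simp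
qed

lemma integral_soft_abs_le:
  assumes "integrable M f"
  shows "(LINT x|M. soft_abs (f x)) \<le> measure M (space M) + (LINT x|M. \<bar>f x\<bar>)"
proof -
  have "(LINT x|M. soft_abs (f x)) \<le> (LINT x|M. 1 + \<bar>f x\<bar>)"
    using assms by (intro integral_mono integrable_soft_abs soft_abs_le) auto
  then show ?thesis using assms by simp
qed

lemma integral_sqrt_abs_diff_martingale_le:
  assumes martingale: "weak_martingale M X" and "k \<le> l" "0 < t"
  shows "(LINT x|M. sqrt \<bar>X l x - X k x\<bar>)
    \<le> t * ((LINT x|M. soft_abs (X k x)) + (LINT x|M. soft_abs (X l x)))
      + ((LINT x|M. soft_abs (X l x)) - (LINT x|M. soft_abs (X k x))) / t ^ 3"
proof -
  note integrable = weak_martingale_integrable[OF martingale]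
    integrable_bregman_martingale[OF martingale \<open>k \<le> l\<close>]
  have "(LINT x|M. sqrt \<bar>X l x - X k x\<bar>)
      \<le> (LINT x|M. t * (soft_abs (X k x) + soft_abs (X l x))
          + soft_abs_bregman (X l x) (X k x) / t ^ 3)"
    using \<open>0 < t\<close> by (intro integral_mono sqrt_abs_diff_le_bregman integrable_sqrt_abs)
      (auto simp: integrable integrable_soft_abs)
  then show ?thesis
    by (simp add: integrable integrable_soft_abs integral_bregman_martingale[OF martingale \<open>k \<le> l\<close>])
qed

lemma Cauchy_integral_soft_abs_martingale:
  assumes martingale: "weak_martingale M X" and bound: "\<And>k. (LINT x|M. \<bar>X k x\<bar>) \<le> B"
  shows "Cauchy (\<lambda>k. LINT x|M. soft_abs (X k x))"
proof -
  have "(LINT x|M. soft_abs (X k x)) \<le> measure M (space M) + B" for k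
    using integral_soft_abs_le[OF weak_martingale_integrable[OF martingale], of k] bound[of k]
    by simp
  moreover have "incseq (\<lambda>k. LINT x|M. soft_abs (X k x))"
    unfolding incseq_def by (intro allI impI integral_soft_abs_martingale_mono martingale)
  ultimately show ?thesis
    by (intro convergent_Cauchy) (metis incseq_convergent convergentI)
qed

lemma L1_bounded_martingale_Lhalf_Cauchy:
  assumes martingale: "weak_martingale M X" and bound: "\<And>k. (LINT x|M. \<bar>X k x\<bar>) \<le> B"
  shows "Lhalf_Cauchy M X"
  unfolding Lhalf_Cauchy_def
proof (intro allI impI)
  fix e :: real assume "0 < e"
  define C where "C = measure M (space M) + B"
  define \<Phi> where "\<Phi> k = (LINT x|M. soft_abs (X k x))" for k
  have \<Phi>_le: "\<Phi> k \<le> C" for k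
    using integral_soft_abs_le[OF weak_martingale_integrable[OF martingale], of k] bound[of k]
    by (simp add: \<Phi>_def C_def)
  have "Cauchy \<Phi>"
    unfolding \<Phi>_def using martingale bound by (rule Cauchy_integral_soft_abs_martingale)
  have "0 \<le> B" by (rule order_trans[OF _ bound[of 0]]) simp
  then have "0 \<le> C" by (simp add: C_def)
  define t where "t = e / (4 * (C + 1))"
  have t_pos: "0 < t" and t_small: "t * (2 * C) < e / 2"
    using \<open>0 < e\<close> \<open>0 \<le> C\<close> by (auto simp: t_def field_simps)
  then have "0 < t ^ 3 * (e / 2)" using \<open>0 < e\<close> by simp
  then obtain N where \<Phi>_close: "\<And>i j. N \<le> i \<Longrightarrow> N \<le> j \<Longrightarrow> \<bar>\<Phi> i - \<Phi> j\<bar> < t ^ 3 * (e / 2)"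
    using \<open>Cauchy \<Phi>\<close> unfolding Cauchy_def dist_real_def by blast
  have small: "(LINT x|M. sqrt \<bar>X l x - X k x\<bar>) < e" if "N \<le> k" "k \<le> l" for k l
  proof -
    have "(LINT x|M. sqrt \<bar>X l x - X k x\<bar>) \<le> t * (\<Phi> k + \<Phi> l) + (\<Phi> l - \<Phi> k) / t ^ 3"
      unfolding \<Phi>_def using martingale \<open>k \<le> l\<close> t_pos by (rule integral_sqrt_abs_diff_martingale_le)
    moreover have "t * (\<Phi> k + \<Phi> l) \<le> t * (2 * C)"
      using t_pos \<Phi>_le[of k] \<Phi>_le[of l] by simp
    moreover have "\<Phi> l - \<Phi> k < t ^ 3 * (e / 2)"
      using \<Phi>_close[of l k] that by linarith
    then have "(\<Phi> l - \<Phi> k) / t ^ 3 < e / 2"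
      using t_pos by (simp add: divide_less_eq mult.commute)
    ultimately show ?thesis using t_small by linarith
  qed
  show "\<exists>N. \<forall>i\<ge>N. \<forall>j\<ge>N. (LINT x|M. sqrt \<bar>X i x - X j x\<bar>) < e"
  proof (intro exI[of _ N] allI impI)
    fix i j assume "N \<le> i" "N \<le> j"
    then show "(LINT x|M. sqrt \<bar>X i x - X j x\<bar>) < e"
      using small[of i j] small[of j i] by (cases "i \<le> j") (simp_all add: abs_minus_commute)
  qed
qed

theorem L1_bounded_martingale_Lhalf_convergent:
  assumes "weak_martingale M X" "\<And>k. (LINT x|M. \<bar>X k x\<bar>) \<le> B"
  obtains g where "integrable M g" "(LINT x|M. \<bar>g x\<bar>) \<le> B" "Lhalf_tendsto M X g"
  using Lhalf_Cauchy_imp_tendsto[OF weak_martingale_integrable[OF assms(1)] assms(2)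
      L1_bounded_martingale_Lhalf_Cauchy[OF assms]] by blast

end

section \<open>Density of continuous functions in \<open>L\<^sub>1\<close>\<close>

definition truncation :: "real \<Rightarrow> real \<Rightarrow> real" where
  "truncation c y = max (- c) (min c y)"

lemma truncation_measurable [measurable]: "truncation c \<in> borel_measurable borel"
  unfolding truncation_def by measurable

lemma abs_truncation_le: "0 \<le> c \<Longrightarrow> \<bar>truncation c y\<bar> \<le> c"
  by (auto simp: truncation_def)

lemma truncation_eq: "\<bar>y\<bar> \<le> c \<Longrightarrow> truncation c y = y"
  by (auto simp: truncation_def)

lemma abs_diff_truncation_le: "0 \<le> c \<Longrightarrow> \<bar>y - truncation c y\<bar> \<le> \<bar>y\<bar>"
  by (auto simp: truncation_def max_def min_def)

lemma continuous_on_truncation [continuous_intros]: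
  "continuous_on S f \<Longrightarrow> continuous_on S (\<lambda>x. truncation c (f x))"
  unfolding truncation_def by (intro continuous_intros)

lemma tendsto_truncation [tendsto_intros]:
  "(f \<longlongrightarrow> l) F \<Longrightarrow> ((\<lambda>x. truncation c (f x)) \<longlongrightarrow> truncation c l) F"
  unfolding truncation_def by (intro tendsto_intros)

lemma L1_tendsto_truncation:
  assumes "integrable M f"
  shows "(\<lambda>n. LINT x|M. \<bar>f x - truncation (real n) (f x)\<bar>) \<longlonglongrightarrow> 0"
proof -
  have [measurable]: "f \<in> borel_measurable M" using assms by (rule borel_measurable_integrable)
  have "(\<lambda>n. LINT x|M. \<bar>f x - truncation (real n) (f x)\<bar>) \<longlonglongrightarrow> (LINT x|M. 0)"
  proof (rule integral_dominated_convergence[where w = "\<lambda>x. \<bar>f x\<bar>"])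
    have "(\<lambda>n. \<bar>y - truncation (real n) y\<bar>) \<longlonglongrightarrow> 0" for y
    proof (rule tendsto_eventually)
      obtain N :: nat where "\<bar>y\<bar> \<le> N" using real_arch_simple by blast
      then have "\<bar>y - truncation (real n) y\<bar> = 0" if "N \<le> n" for n
        using that by (simp add: truncation_eq)
      then show "\<forall>\<^sub>F n in sequentially. \<bar>y - truncation (real n) y\<bar> = 0"
        by (rule eventually_sequentiallyI)
    qed
    then show "AE x in M. (\<lambda>n. \<bar>f x - truncation (real n) (f x)\<bar>) \<longlonglongrightarrow> 0" by simp
    show "AE x in M. norm \<bar>f x - truncation (real n) (f x)\<bar> \<le> \<bar>f x\<bar>" for n
      by (intro AE_I2) (simp add: abs_diff_truncation_le)
  qed (use assms in auto)
  then show ?thesis by simp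
qed

lemma borel_measurable_AE_limit_continuous:
  fixes f :: "'a :: euclidean_space \<Rightarrow> 'b :: euclidean_space"
  assumes "S \<in> sets lebesgue" "f \<in> borel_measurable (lebesgue_on S)"
  obtains h where "\<And>n. continuous_on UNIV (h n)" "AE x in lebesgue_on S. (\<lambda>n. h n x) \<longlonglongrightarrow> f x"
proof -
  have "f measurable_on S"
    using assms by (simp add: measurable_on_iff_borel_measurable)
  then obtain N h where "negligible N" and continuous: "\<And>n. continuous_on UNIV (h n)"
    and limit: "\<And>x. x \<notin> N \<Longrightarrow> (\<lambda>n. h n x) \<longlonglongrightarrow> (if x \<in> S then f x else 0)"
    unfolding measurable_on_def by blast
  have "AE x in lebesgue. x \<notin> N"
    using \<open>negligible N\<close> by (intro AE_not_in) (simp add: negligible_iff_null_sets)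
  then have "AE x in lebesgue. x \<in> S \<longrightarrow> (\<lambda>n. h n x) \<longlonglongrightarrow> f x"
    by eventually_elim (use limit in fastforce)
  then have "AE x in lebesgue_on S. (\<lambda>n. h n x) \<longlonglongrightarrow> f x"
    using assms(1) by (simp add: AE_restrict_space_iff)
  with continuous show ?thesis using that by blast
qed

lemma L1_approx_continuous_bounded:
  fixes f :: "'a :: euclidean_space \<Rightarrow> real"
  assumes S: "S \<in> lmeasurable" and [measurable]: "f \<in> borel_measurable (lebesgue_on S)"
    and bound: "\<And>x. \<bar>f x\<bar> \<le> c" and "0 < e"
  obtains g where "continuous_on UNIV g" "integrable (lebesgue_on S) g"
    "(LINT x|lebesgue_on S. \<bar>f x - g x\<bar>) < e"
proof -
  interpret finite_measure "lebesgue_on S"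
    using S by (rule finite_measure_lebesgue_on)
  have sets: "S \<in> sets lebesgue" using S by (rule fmeasurableD)
  obtain h where h: "\<And>n. continuous_on UNIV (h n)" "AE x in lebesgue_on S. (\<lambda>n. h n x) \<longlonglongrightarrow> f x"
    using borel_measurable_AE_limit_continuous[OF sets assms(2)] by blast
  define g where "g n x = truncation c (h n x)" for n x
  have continuous: "continuous_on UNIV (g n)" for n
    unfolding g_def by (intro continuous_intros h)
  then have [measurable]: "g n \<in> borel_measurable (lebesgue_on S)" for n
    using sets
    by (intro continuous_imp_measurable_on_sets_lebesgue) (auto intro: continuous_on_subset)
  have "0 \<le> c" using bound[of undefined] by linarith
  then have g_bound: "\<bar>g n x\<bar> \<le> c" for n x by (simp add: g_def abs_truncation_le)
  have integrable: "integrable (lebesgue_on S) (g n)" for n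
    using g_bound by (intro integrable_const_bound[where B = c]) auto
  have "(\<lambda>n. LINT x|lebesgue_on S. \<bar>f x - g n x\<bar>) \<longlonglongrightarrow> (LINT x|lebesgue_on S. 0)"
  proof (rule integral_dominated_convergence[where w = "\<lambda>_. 2 * c"])
    show "AE x in lebesgue_on S. (\<lambda>n. \<bar>f x - g n x\<bar>) \<longlonglongrightarrow> 0"
      using h(2)
    proof eventually_elim
      case (elim x)
      then have "(\<lambda>n. \<bar>f x - g n x\<bar>) \<longlonglongrightarrow> \<bar>f x - truncation c (f x)\<bar>"
        unfolding g_def by (intro tendsto_intros)
      then show ?case by (simp add: truncation_eq bound)
    qed
    have "\<bar>f x - g n x\<bar> \<le> 2 * c" for n x
      using bound[of x] g_bound[of n x] by linarith
    then show "AE x in lebesgue_on S. norm \<bar>f x - g n x\<bar> \<le> 2 * c" for n by simp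
  qed auto
  from LIMSEQ_D[OF this \<open>0 < e\<close>] obtain n where "(LINT x|lebesgue_on S. \<bar>f x - g n x\<bar>) < e"
    by auto
  then show ?thesis using continuous integrable that by blast
qed

theorem L1_approx_continuous:
  fixes f :: "'a :: euclidean_space \<Rightarrow> real"
  assumes S: "S \<in> lmeasurable" and f: "integrable (lebesgue_on S) f" and "0 < e"
  obtains g where "continuous_on UNIV g" "integrable (lebesgue_on S) g"
    "(LINT x|lebesgue_on S. \<bar>f x - g x\<bar>) < e"
proof -
  interpret finite_measure "lebesgue_on S"
    using S by (rule finite_measure_lebesgue_on)
  have [measurable]: "f \<in> borel_measurable (lebesgue_on S)"
    using f by (rule borel_measurable_integrable)
  obtain n :: nat where truncate: "(LINT x|lebesgue_on S. \<bar>f x - truncation n (f x)\<bar>) < e / 2"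
    using LIMSEQ_D[OF L1_tendsto_truncation[OF f] half_gt_zero[OF \<open>0 < e\<close>]] by auto
  have truncation_integrable: "integrable (lebesgue_on S) (\<lambda>x. truncation n (f x))"
    by (intro integrable_const_bound[where B = n]) (simp_all add: abs_truncation_le)
  obtain g where g: "continuous_on UNIV g" "integrable (lebesgue_on S) g"
      "(LINT x|lebesgue_on S. \<bar>truncation n (f x) - g x\<bar>) < e / 2"
    using L1_approx_continuous_bounded[of S "\<lambda>x. truncation n (f x)" n "e / 2"] S \<open>0 < e\<close>
    by (auto simp: abs_truncation_le)
  have "(LINT x|lebesgue_on S. \<bar>f x - g x\<bar>)
      \<le> (LINT x|lebesgue_on S. \<bar>f x - truncation n (f x)\<bar> + \<bar>truncation n (f x) - g x\<bar>)"
    using f g(2) truncation_integrable by (intro integral_mono) auto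
  also have "\<dots> < e" using truncate g(2,3) f truncation_integrable by simp
  finally show ?thesis using g(1,2) that by blast
qed

section \<open>Sequences indexed by the dyadic tree\<close>

text \<open>Heap order: the root is \<open>0\<close> and the children of \<open>n\<close> are \<open>2 * n + 1\<close> and \<open>2 * n + 2\<close>, so level
  \<open>k\<close> is the block \<open>2 ^ k - 1, \<dots>, 2 ^ Suc k - 2\<close>.\<close>

definition heap_level :: "nat \<Rightarrow> nat" where
  "heap_level n = floor_log (Suc n)"

definition heap_parent :: "nat \<Rightarrow> nat" where
  "heap_parent n = (n - 1) div 2"

definition child_mean :: "(nat \<Rightarrow> real) \<Rightarrow> nat \<Rightarrow> real" where
  "child_mean a n = (a (2 * n + 1) + a (2 * n + 2)) / 2"

definition level_mean :: "nat \<Rightarrow> (nat \<Rightarrow> real) \<Rightarrow> real" where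
  "level_mean k a = (\<Sum>n | heap_level n = k. a n) / 2 ^ k"

definition level_bounded :: "real \<Rightarrow> (nat \<Rightarrow> real) \<Rightarrow> bool" where
  "level_bounded B a \<longleftrightarrow> (\<forall>k. level_mean k (\<lambda>n. \<bar>a n\<bar>) \<le> B)"

definition dyadic_martingale :: "(nat \<Rightarrow> real) \<Rightarrow> bool" where
  "dyadic_martingale b \<longleftrightarrow> child_mean b = b"

lemma heap_level_eq_iff: "heap_level n = k \<longleftrightarrow> 2 ^ k \<le> Suc n \<and> Suc n < 2 ^ Suc k"
  using floor_log_exp2_le[of "Suc n"] floor_log_exp2_gt[of "Suc n"] floor_log_eqI[of "Suc n" k]
  by (auto simp: heap_level_def)

lemma heap_level_children [simp]:
  "heap_level (Suc (2 * n)) = Suc (heap_level n)"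
  "heap_level (Suc (Suc (2 * n))) = Suc (heap_level n)"
  by (simp_all add: heap_level_def floor_log_rec)

lemma finite_heap_level [simp]: "finite {n. heap_level n = k}"
  by (rule finite_subset[of _ "{..<2 ^ Suc k}"]) (auto simp: heap_level_eq_iff)

lemma sum_heap_level_Suc:
  fixes h :: "nat \<Rightarrow> 'a :: comm_monoid_add"
  shows "(\<Sum>n | heap_level n = Suc k. h n) = (\<Sum>n | heap_level n = k. h (2 * n + 1) + h (2 * n + 2))"
proof -
  let ?level = "{n. heap_level n = k}"
  have "n \<in> (\<lambda>n. 2 * n + 1) ` ?level \<union> (\<lambda>n. 2 * n + 2) ` ?level" if "heap_level n = Suc k" for n
  proof (cases "odd n")
    case True
    then obtain m where "n = 2 * m + 1" by (rule oddE)
    then show ?thesis using that by simp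
  next
    case False
    have "n \<noteq> 0" using that by (intro notI) (simp add: heap_level_def)
    with False have "n = 2 * (n div 2 - 1) + 2" by presburger
    then obtain m where "n = 2 * m + 2" by blast
    then show ?thesis using that by simp
  qed
  then have "{n. heap_level n = Suc k} = (\<lambda>n. 2 * n + 1) ` ?level \<union> (\<lambda>n. 2 * n + 2) ` ?level"
    by auto
  moreover have "(\<lambda>n. 2 * n + 1) ` ?level \<inter> (\<lambda>n. 2 * n + 2) ` ?level = {}" by auto presburger
  ultimately show ?thesis
    by (simp add: sum.union_disjoint sum.reindex inj_on_def sum.distrib)
qed

lemma level_mean_Suc: "level_mean (Suc k) a = level_mean k (child_mean a)"
  by (simp add: level_mean_def sum_heap_level_Suc child_mean_def sum_divide_distrib[symmetric])

lemma level_mean_add_funpow: "level_mean (i + k) a = level_mean k ((child_mean ^^ i) a)"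
  by (induction i arbitrary: a) (simp_all add: level_mean_Suc funpow_Suc_right del: funpow.simps(2))

lemma level_mean_mono: "(\<And>n. a n \<le> b n) \<Longrightarrow> level_mean k a \<le> level_mean k b"
  by (simp add: level_mean_def sum_mono divide_right_mono)

lemma le_level_mean:
  assumes "\<And>n. 0 \<le> a n"
  shows "a n \<le> 2 ^ heap_level n * level_mean (heap_level n) a"
  using member_le_sum[of n "{m. heap_level m = heap_level n}" a] assms by (simp add: level_mean_def)

lemma abs_funpow_child_mean_le:
  "\<bar>(child_mean ^^ i) a n\<bar> \<le> (child_mean ^^ i) (\<lambda>n. \<bar>a n\<bar>) n"
proof (induction i arbitrary: n)
  case (Suc i)
  have "\<bar>(child_mean ^^ Suc i) a n\<bar>
      \<le> (\<bar>(child_mean ^^ i) a (2 * n + 1)\<bar> + \<bar>(child_mean ^^ i) a (2 * n + 2)\<bar>) / 2"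
    by (simp add: child_mean_def[of "(child_mean ^^ i) a"])
  also have "\<dots> \<le> (child_mean ^^ Suc i) (\<lambda>n. \<bar>a n\<bar>) n"
    using Suc[of "2 * n + 1"] Suc[of "2 * n + 2"]
    by (simp add: child_mean_def[of "(child_mean ^^ i) (\<lambda>n. \<bar>a n\<bar>)"])
  finally show ?case .
qed simp

lemma level_bounded_funpow_child_mean:
  assumes "level_bounded B a"
  shows "level_bounded B ((child_mean ^^ i) a)"
  unfolding level_bounded_def
proof
  fix k
  have "level_mean k (\<lambda>n. \<bar>(child_mean ^^ i) a n\<bar>) \<le> level_mean k ((child_mean ^^ i) (\<lambda>n. \<bar>a n\<bar>))"
    by (intro level_mean_mono abs_funpow_child_mean_le)
  also have "\<dots> \<le> B"
    using assms by (simp add: level_bounded_def level_mean_add_funpow[symmetric])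
  finally show "level_mean k (\<lambda>n. \<bar>(child_mean ^^ i) a n\<bar>) \<le> B" .
qed

lemma abs_le_level_bounded:
  assumes "level_bounded B a"
  shows "\<bar>a n\<bar> \<le> 2 ^ heap_level n * B"
proof -
  have "\<bar>a n\<bar> \<le> 2 ^ heap_level n * level_mean (heap_level n) (\<lambda>n. \<bar>a n\<bar>)"
    by (rule le_level_mean) simp
  also have "\<dots> \<le> 2 ^ heap_level n * B"
    using assms by (simp add: level_bounded_def)
  finally show ?thesis .
qed

lemma level_bounded_linear:
  assumes "level_bounded A a" "level_bounded B b"
  shows "level_bounded (\<bar>\<alpha>\<bar> * A + \<bar>\<beta>\<bar> * B) (\<lambda>n. \<alpha> * a n + \<beta> * b n)"
  unfolding level_bounded_def
proof
  fix k
  have "level_mean k (\<lambda>n. \<bar>\<alpha> * a n + \<beta> * b n\<bar>) \<le> level_mean k (\<lambda>n. \<bar>\<alpha>\<bar> * \<bar>a n\<bar> + \<bar>\<beta>\<bar> * \<bar>b n\<bar>)"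
    by (intro level_mean_mono) (metis abs_mult abs_triangle_ineq)
  also have "\<dots> = \<bar>\<alpha>\<bar> * level_mean k (\<lambda>n. \<bar>a n\<bar>) + \<bar>\<beta>\<bar> * level_mean k (\<lambda>n. \<bar>b n\<bar>)"
    by (simp add: level_mean_def sum.distrib sum_distrib_left[symmetric] add_divide_distrib)
  also have "\<dots> \<le> \<bar>\<alpha>\<bar> * A + \<bar>\<beta>\<bar> * B"
    using assms by (intro add_mono mult_left_mono) (auto simp: level_bounded_def)
  finally show "level_mean k (\<lambda>n. \<bar>\<alpha> * a n + \<beta> * b n\<bar>) \<le> \<bar>\<alpha>\<bar> * A + \<bar>\<beta>\<bar> * B" .
qed

lemma dyadic_martingale_funpow:
  assumes "dyadic_martingale b"
  shows "(child_mean ^^ i) b = b"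
  using assms by (induction i) (simp_all add: dyadic_martingale_def)

lemma child_mean_linear:
  "child_mean (\<lambda>n. \<alpha> * a n + \<beta> * b n) = (\<lambda>n. \<alpha> * child_mean a n + \<beta> * child_mean b n)"
  by (simp add: fun_eq_iff child_mean_def algebra_simps add_divide_distrib)

lemma dyadic_martingale_linear:
  assumes "dyadic_martingale a" "dyadic_martingale b"
  shows "dyadic_martingale (\<lambda>n. \<alpha> * a n + \<beta> * b n)"
  using assms by (simp add: dyadic_martingale_def child_mean_linear)

lemma funpow_child_mean_linear:
  "(child_mean ^^ i) (\<lambda>n. \<alpha> * a n + \<beta> * b n)
    = (\<lambda>n. \<alpha> * (child_mean ^^ i) a n + \<beta> * (child_mean ^^ i) b n)"
  by (induction i) (simp_all add: child_mean_linear)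

text \<open>Truncated subtraction makes this \<open>a n\<close> if level \<open>N\<close> lies above \<open>n\<close>.\<close>

definition descendant_mean :: "nat \<Rightarrow> (nat \<Rightarrow> real) \<Rightarrow> nat \<Rightarrow> real" where
  "descendant_mean N a n = (child_mean ^^ (N - heap_level n)) a n"

definition dyadic_limit :: "(nat \<Rightarrow> real) \<Rightarrow> nat \<Rightarrow> real" where
  "dyadic_limit a n = ultralim (\<lambda>N. descendant_mean N a n)"

lemma descendant_mean_children:
  assumes "heap_level n < N"
  shows "(descendant_mean N a (2 * n + 1) + descendant_mean N a (2 * n + 2)) / 2
    = descendant_mean N a n"
proof -
  define i where "i = N - Suc (heap_level n)"
  have "N - heap_level n = Suc i" using assms by (simp add: i_def)
  then have "descendant_mean N a n = child_mean ((child_mean ^^ i) a) n"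
    by (simp add: descendant_mean_def)
  then show ?thesis by (simp only: child_mean_def i_def) (simp add: descendant_mean_def)
qed

lemma level_mean_abs_descendant_mean_le:
  assumes "level_bounded B a"
  shows "level_mean k (\<lambda>n. \<bar>descendant_mean N a n\<bar>) \<le> B"
proof -
  have "level_mean k (\<lambda>n. \<bar>descendant_mean N a n\<bar>)
      = level_mean k (\<lambda>n. \<bar>(child_mean ^^ (N - k)) a n\<bar>)"
    by (simp add: level_mean_def descendant_mean_def)
  then show ?thesis
    using level_bounded_funpow_child_mean[OF assms] by (simp add: level_bounded_def)
qed

lemma tendsto_dyadic_limit:
  assumes "level_bounded B a"
  shows "((\<lambda>N. descendant_mean N a n) \<longlongrightarrow> dyadic_limit a n) free_ultrafilter"
  unfolding dyadic_limit_def descendant_mean_def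
  by (rule tendsto_ultralim[where B = "2 ^ heap_level n * B"])
    (simp add: abs_le_level_bounded level_bounded_funpow_child_mean assms)

lemma dyadic_limit_linear:
  assumes "level_bounded A a" "level_bounded B b"
  shows "dyadic_limit (\<lambda>n. \<alpha> * a n + \<beta> * b n) = (\<lambda>n. \<alpha> * dyadic_limit a n + \<beta> * dyadic_limit b n)"
proof
  fix n
  have "descendant_mean N (\<lambda>n. \<alpha> * a n + \<beta> * b n) n
      = \<alpha> * descendant_mean N a n + \<beta> * descendant_mean N b n" for N
    by (simp add: descendant_mean_def funpow_child_mean_linear)
  then show "dyadic_limit (\<lambda>n. \<alpha> * a n + \<beta> * b n) n = \<alpha> * dyadic_limit a n + \<beta> * dyadic_limit b n"
    using assms unfolding dyadic_limit_def[of "\<lambda>n. \<alpha> * a n + \<beta> * b n"]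
    by (auto intro!: ultralim_eqI tendsto_intros tendsto_dyadic_limit)
qed

lemma dyadic_martingale_dyadic_limit:
  assumes "level_bounded B a"
  shows "dyadic_martingale (dyadic_limit a)"
  unfolding dyadic_martingale_def
proof
  fix n
  note limit = tendsto_dyadic_limit[OF assms]
  have "((\<lambda>N. (descendant_mean N a (2 * n + 1) + descendant_mean N a (2 * n + 2)) / 2)
      \<longlongrightarrow> child_mean (dyadic_limit a) n) free_ultrafilter"
    unfolding child_mean_def by (intro tendsto_intros limit) simp
  moreover have "\<forall>\<^sub>F N in free_ultrafilter.
      (descendant_mean N a (2 * n + 1) + descendant_mean N a (2 * n + 2)) / 2
        = descendant_mean N a n"
    by (intro eventually_free_ultrafilter eventually_sequentiallyI[where c = "Suc (heap_level n)"]
        descendant_mean_children) simp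
  ultimately have "((\<lambda>N. descendant_mean N a n) \<longlongrightarrow> child_mean (dyadic_limit a) n) free_ultrafilter"
    by (rule Lim_transform_eventually)
  then show "child_mean (dyadic_limit a) n = dyadic_limit a n"
    using limit by (rule tendsto_unique[OF free_ultrafilter_neq_bot])
qed

lemma dyadic_limit_martingale:
  assumes "dyadic_martingale b"
  shows "dyadic_limit b = b"
  by (simp add: fun_eq_iff dyadic_limit_def descendant_mean_def dyadic_martingale_funpow assms
      ultralim_eqI)

lemma level_bounded_dyadic_limit:
  assumes "level_bounded B a"
  shows "level_bounded B (dyadic_limit a)"
  unfolding level_bounded_def
proof
  fix k
  have "((\<lambda>N. level_mean k (\<lambda>n. \<bar>descendant_mean N a n\<bar>))
      \<longlongrightarrow> level_mean k (\<lambda>n. \<bar>dyadic_limit a n\<bar>)) free_ultrafilter"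
    unfolding level_mean_def by (intro tendsto_intros tendsto_dyadic_limit[OF assms]) simp
  then show "level_mean k (\<lambda>n. \<bar>dyadic_limit a n\<bar>) \<le> B"
    by (rule tendsto_upperbound)
      (simp_all add: level_mean_abs_descendant_mean_le assms free_ultrafilter_neq_bot)
qed

section \<open>Dyadic martingales on the unit interval\<close>

abbreviation unit_lebesgue :: "real measure" where
  "unit_lebesgue \<equiv> lebesgue_on {0..<1}"

lemma lmeasurable_unit: "{0..<1::real} \<in> lmeasurable"
  by (rule bounded_set_imp_lmeasurable) auto

interpretation unit: finite_measure unit_lebesgue
  using lmeasurable_unit by (rule finite_measure_lebesgue_on)

text \<open>With the unit interval shifted to \<open>[1,2)\<close>, the cell of a node \<open>n\<close> at level \<open>k\<close> begins at
  \<open>(n + 1) / 2 ^ k\<close>.\<close>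

definition dyadic_cell :: "nat \<Rightarrow> real set" where
  "dyadic_cell n = {(real n + 1) / 2 ^ heap_level n - 1 ..< (real n + 2) / 2 ^ heap_level n - 1}"

definition node :: "nat \<Rightarrow> real \<Rightarrow> nat" where
  "node k x = nat (\<lfloor>2 ^ k * (1 + x)\<rfloor> - 1)"

definition cell_average :: "(real \<Rightarrow> real) \<Rightarrow> nat \<Rightarrow> real" where
  "cell_average f n = 2 ^ heap_level n * (LINT x:dyadic_cell n|unit_lebesgue. f x)"

lemma dyadic_cell_subset: "dyadic_cell n \<subseteq> {0..<1}"
proof -
  have "2 ^ heap_level n \<le> n + 1" "n + 2 \<le> 2 * 2 ^ heap_level n"
    using heap_level_eq_iff[of n "heap_level n"] by auto
  then have "real (2 ^ heap_level n) \<le> real (n + 1)" "real (n + 2) \<le> real (2 * 2 ^ heap_level n)"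
    by (simp_all only: of_nat_le_iff)
  then show ?thesis
    by (auto simp: dyadic_cell_def field_simps)
qed

lemma sets_dyadic_cell [measurable, simp]: "dyadic_cell n \<in> sets unit_lebesgue"
  using dyadic_cell_subset[of n] by (simp add: sets_restrict_space_iff) (simp add: dyadic_cell_def)

lemma dyadic_cell_children:
  "dyadic_cell (2 * n + 1) \<union> dyadic_cell (2 * n + 2) = dyadic_cell n"
  "dyadic_cell (2 * n + 1) \<inter> dyadic_cell (2 * n + 2) = {}"
proof -
  let ?l = "heap_level n"
  have "dyadic_cell (2 * n + 1) = {(real n + 1) / 2 ^ ?l - 1 ..< (real n + 3 / 2) / 2 ^ ?l - 1}"
    "dyadic_cell (2 * n + 2) = {(real n + 3 / 2) / 2 ^ ?l - 1 ..< (real n + 2) / 2 ^ ?l - 1}"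
    by (simp_all add: dyadic_cell_def add_divide_distrib add.commute)
  then show "dyadic_cell (2 * n + 1) \<union> dyadic_cell (2 * n + 2) = dyadic_cell n"
    "dyadic_cell (2 * n + 1) \<inter> dyadic_cell (2 * n + 2) = {}"
    by (simp_all add: dyadic_cell_def ivl_disj_un_two(3) divide_right_mono)
qed

lemma node_eq_iff:
  assumes "x \<in> {0..<1}"
  shows "node k x = n \<longleftrightarrow> heap_level n = k \<and> x \<in> dyadic_cell n"
proof -
  have bounds: "2 ^ k \<le> 2 ^ k * (1 + x)" "2 ^ k * (1 + x) < 2 * 2 ^ k"
    using assms by auto
  have "1 \<le> \<lfloor>2 ^ k * (1 + x)\<rfloor>"
    using bounds(1) one_le_power[of "2::real" k] by linarith
  then have "node k x = n \<longleftrightarrow> \<lfloor>2 ^ k * (1 + x)\<rfloor> = int n + 1"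
    by (auto simp: node_def)
  also have "\<dots> \<longleftrightarrow> real n + 1 \<le> 2 ^ k * (1 + x) \<and> 2 ^ k * (1 + x) < real n + 2"
    by (simp add: floor_eq_iff add.commute add.left_commute)
  also have "\<dots> \<longleftrightarrow> heap_level n = k \<and> real n + 1 \<le> 2 ^ k * (1 + x) \<and> 2 ^ k * (1 + x) < real n + 2"
  proof -
    have "heap_level n = k" if "real n + 1 \<le> 2 ^ k * (1 + x)" "2 ^ k * (1 + x) < real n + 2"
    proof -
      have "2 ^ k < real n + 2" "real n + 1 < 2 * 2 ^ k"
        using bounds that by linarith+
      then have "real (2 ^ k) < real (n + 2)" "real (n + 1) < real (2 * 2 ^ k)" by simp_all
      then have "2 ^ k < n + 2" "n + 1 < 2 * 2 ^ k"
        by (simp_all only: of_nat_less_iff)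
      then show ?thesis by (simp add: heap_level_eq_iff)
    qed
    then show ?thesis by blast
  qed
  also have "\<dots> \<longleftrightarrow> heap_level n = k \<and> x \<in> dyadic_cell n"
    by (auto simp: dyadic_cell_def field_simps)
  finally show ?thesis .
qed

lemma heap_level_node: "x \<in> {0..<1} \<Longrightarrow> heap_level (node k x) = k"
  using node_eq_iff by blast

lemma heap_parent_node:
  assumes "x \<in> {0..<1}"
  shows "heap_parent (node (Suc k) x) = node k x"
proof -
  let ?n = "node k x"
  have "heap_level ?n = k" "x \<in> dyadic_cell ?n"
    using node_eq_iff[OF assms] by blast+
  then have "node (Suc k) x = 2 * ?n + 1 \<or> node (Suc k) x = 2 * ?n + 2"
    unfolding node_eq_iff[OF assms] dyadic_cell_children(1)[of ?n, symmetric] by auto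
  then show ?thesis by (auto simp: heap_parent_def)
qed

lemma set_integrable_dyadic_cell:
  fixes f :: "real \<Rightarrow> real"
  shows "integrable unit_lebesgue f \<Longrightarrow> set_integrable unit_lebesgue (dyadic_cell n) f"
  unfolding set_integrable_def by (rule integrable_mult_indicator) simp_all

lemma cell_average_linear:
  assumes "integrable unit_lebesgue f" "integrable unit_lebesgue g"
  shows "cell_average (\<lambda>x. \<alpha> * f x + \<beta> * g x) = (\<lambda>n. \<alpha> * cell_average f n + \<beta> * cell_average g n)"
  using assms by (simp add: fun_eq_iff cell_average_def set_integrable_dyadic_cell algebra_simps)

lemma cell_average_mono:
  assumes "integrable unit_lebesgue f" "integrable unit_lebesgue g"
    and "\<And>x. x \<in> dyadic_cell n \<Longrightarrow> f x \<le> g x"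
  shows "cell_average f n \<le> cell_average g n"
  unfolding cell_average_def
  using assms by (intro mult_left_mono set_integral_mono set_integrable_dyadic_cell) auto

lemma abs_cell_average_le: "\<bar>cell_average f n\<bar> \<le> cell_average (\<lambda>x. \<bar>f x\<bar>) n"
  unfolding cell_average_def abs_mult set_lebesgue_integral_def
  by (auto intro!: mult_left_mono integral_abs_bound[THEN order_trans] simp: abs_mult)

lemma cell_average_cong_AE:
  assumes "integrable unit_lebesgue f" "integrable unit_lebesgue g"
    and "AE x in unit_lebesgue. f x = g x"
  shows "cell_average f = cell_average g"
proof
  fix n
  have "(LINT x:dyadic_cell n|unit_lebesgue. f x) = (LINT x:dyadic_cell n|unit_lebesgue. g x)"
    unfolding set_lebesgue_integral_def
    using assms by (intro integral_cong_AE) (auto elim: eventually_mono)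
  then show "cell_average f n = cell_average g n" by (simp add: cell_average_def)
qed

lemma cell_average_const [simp]: "cell_average (\<lambda>x. c) n = c"
proof -
  have "measure unit_lebesgue (dyadic_cell n) = measure lebesgue (dyadic_cell n)"
    using dyadic_cell_subset by (intro measure_restrict_space) auto
  also have "\<dots> = 1 / 2 ^ heap_level n"
    by (simp add: dyadic_cell_def diff_divide_distrib[symmetric] divide_right_mono)
  finally show ?thesis
    by (simp add: cell_average_def set_lebesgue_integral_def Int_absorb2 dyadic_cell_subset)
qed

lemma dyadic_martingale_cell_average:
  assumes "integrable unit_lebesgue f"
  shows "dyadic_martingale (cell_average f)"
  unfolding dyadic_martingale_def
proof
  fix n
  have "(LINT x:dyadic_cell n|unit_lebesgue. f x)
      = (LINT x:dyadic_cell (2 * n + 1)|unit_lebesgue. f x)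
        + (LINT x:dyadic_cell (2 * n + 2)|unit_lebesgue. f x)"
    unfolding dyadic_cell_children(1)[of n, symmetric]
    using assms by (intro set_integral_Un dyadic_cell_children(2) set_integrable_dyadic_cell)
  then show "child_mean (cell_average f) n = cell_average f n"
    by (simp add: child_mean_def cell_average_def distrib_left)
qed

lemma
  assumes f: "integrable unit_lebesgue f"
  shows integrable_node_mult: "integrable unit_lebesgue (\<lambda>x. u (node k x) * f x)"
    and integral_node_mult:
      "(LINT x|unit_lebesgue. u (node k x) * f x) = level_mean k (\<lambda>n. u n * cell_average f n)"
proof -
  have cell_sum:
    "u (node k x) * f x = (\<Sum>n | heap_level n = k. u n * (indicator (dyadic_cell n) x *\<^sub>R f x))"
    if "x \<in> space unit_lebesgue" for x
  proof -
    have x: "x \<in> {0..<1}" using that by simp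
    have "(\<Sum>n | heap_level n = k. u n * (indicator (dyadic_cell n) x *\<^sub>R f x))
        = (\<Sum>n | heap_level n = k. if n = node k x then u n * f x else 0)"
    proof (rule sum.cong[OF refl])
      fix n assume "n \<in> {n. heap_level n = k}"
      then have "n = node k x \<longleftrightarrow> x \<in> dyadic_cell n"
        using node_eq_iff[OF x, of k n] by auto
      then show "u n * (indicator (dyadic_cell n) x *\<^sub>R f x)
          = (if n = node k x then u n * f x else 0)"
        by (simp add: indicator_def)
    qed
    then show ?thesis using heap_level_node[OF x] by simp
  qed
  have integrable_cell: "integrable unit_lebesgue (\<lambda>x. indicator (dyadic_cell n) x *\<^sub>R f x)" for n
    using set_integrable_dyadic_cell[OF f] by (simp add: set_integrable_def)
  show "integrable unit_lebesgue (\<lambda>x. u (node k x) * f x)"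
    by (subst Bochner_Integration.integrable_cong[OF refl cell_sum])
      (assumption, intro Bochner_Integration.integrable_sum integrable_mult_right integrable_cell)
  have "(LINT x|unit_lebesgue. u (node k x) * f x)
      = (\<Sum>n | heap_level n = k. u n * (LINT x:dyadic_cell n|unit_lebesgue. f x))"
    unfolding set_lebesgue_integral_def using integrable_cell
    by (subst Bochner_Integration.integral_cong[OF refl cell_sum]) auto
  also have "\<dots> = level_mean k (\<lambda>n. u n * cell_average f n)"
    unfolding level_mean_def sum_divide_distrib
    by (intro sum.cong) (auto simp: cell_average_def)
  finally show "(LINT x|unit_lebesgue. u (node k x) * f x)
      = level_mean k (\<lambda>n. u n * cell_average f n)" .
qed

lemma
  fixes u :: "nat \<Rightarrow> real"
  shows integrable_node [simp]: "integrable unit_lebesgue (\<lambda>x. u (node k x))"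
    and integral_node: "(LINT x|unit_lebesgue. u (node k x)) = level_mean k u"
  using integrable_node_mult[of "\<lambda>x. 1" u k] integral_node_mult[of "\<lambda>x. 1" u k] by simp_all

lemma child_mean_parent_mult: "child_mean (\<lambda>n. u (heap_parent n) * b n) n = u n * child_mean b n"
  by (simp add: child_mean_def heap_parent_def distrib_left add_divide_distrib)

lemma integral_node_parent_mult:
  "(LINT x|unit_lebesgue. u (node k x) * b (node l x))
    = (LINT x|unit_lebesgue. u (heap_parent (node (Suc k) x)) * b (node l x))"
  by (intro Bochner_Integration.integral_cong) (auto simp: heap_parent_node)

lemma integral_node_mult_martingale_Suc:
  assumes "dyadic_martingale b"
  shows "(LINT x|unit_lebesgue. u (node k x) * b (node (Suc k) x))
    = (LINT x|unit_lebesgue. u (node k x) * b (node k x))"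
proof -
  have "(LINT x|unit_lebesgue. u (node k x) * b (node (Suc k) x))
      = level_mean k (child_mean (\<lambda>n. u (heap_parent n) * b n))"
    unfolding integral_node_parent_mult level_mean_Suc[symmetric] by (rule integral_node)
  also have "\<dots> = level_mean k (\<lambda>n. u n * b n)"
    using assms by (simp add: level_mean_def child_mean_parent_mult dyadic_martingale_def)
  also have "\<dots> = (LINT x|unit_lebesgue. u (node k x) * b (node k x))"
    by (rule integral_node[symmetric])
  finally show ?thesis .
qed

lemma integral_node_mult_martingale:
  assumes martingale: "dyadic_martingale b" and "k \<le> l"
  shows "(LINT x|unit_lebesgue. u (node k x) * b (node l x))
    = (LINT x|unit_lebesgue. u (node k x) * b (node k x))"
  using \<open>k \<le> l\<close>
proof (induction arbitrary: u rule: inc_induct)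
  case (step k)
  have "(LINT x|unit_lebesgue. u (node k x) * b (node l x))
      = (LINT x|unit_lebesgue. u (heap_parent (node (Suc k) x)) * b (node (Suc k) x))"
    unfolding integral_node_parent_mult[of u k b l] by (rule step.IH)
  also have "\<dots> = (LINT x|unit_lebesgue. u (node k x) * b (node (Suc k) x))"
    by (rule integral_node_parent_mult[symmetric])
  also have "\<dots> = (LINT x|unit_lebesgue. u (node k x) * b (node k x))"
    using martingale by (rule integral_node_mult_martingale_Suc)
  finally show ?case .
qed simp

lemma weak_martingale_node:
  assumes "dyadic_martingale b"
  shows "weak_martingale unit_lebesgue (\<lambda>k x. b (node k x))"
  unfolding weak_martingale_def
proof (intro conjI ballI allI impI)
  fix h :: "real \<Rightarrow> real" and k l :: nat assume "k \<le> l"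
  then show "(LINT x|unit_lebesgue. h (b (node k x)) * b (node l x))
      = (LINT x|unit_lebesgue. h (b (node k x)) * b (node k x))"
    by (rule integral_node_mult_martingale[OF assms, where u = "\<lambda>n. h (b n)"])
qed simp

definition martingale_limit :: "(nat \<Rightarrow> real) \<Rightarrow> real \<Rightarrow> real" where
  "martingale_limit b = (SOME g. integrable unit_lebesgue g \<and>
    Lhalf_tendsto unit_lebesgue (\<lambda>k x. b (node k x)) g)"

lemma
  assumes martingale: "dyadic_martingale b" and bound: "level_bounded B b"
  shows integrable_martingale_limit: "integrable unit_lebesgue (martingale_limit b)"
    and Lhalf_tendsto_martingale_limit:
      "Lhalf_tendsto unit_lebesgue (\<lambda>k x. b (node k x)) (martingale_limit b)"
    and integral_abs_martingale_limit_le: "(LINT x|unit_lebesgue. \<bar>martingale_limit b x\<bar>) \<le> B"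
proof -
  have "(LINT x|unit_lebesgue. \<bar>b (node k x)\<bar>) \<le> B" for k
    using bound integral_node[of "\<lambda>n. \<bar>b n\<bar>" k] by (simp add: level_bounded_def)
  then obtain g where g: "integrable unit_lebesgue g" "(LINT x|unit_lebesgue. \<bar>g x\<bar>) \<le> B"
      "Lhalf_tendsto unit_lebesgue (\<lambda>k x. b (node k x)) g"
    using unit.L1_bounded_martingale_Lhalf_convergent[OF weak_martingale_node[OF martingale]]
    by blast
  then have "\<exists>g. integrable unit_lebesgue g \<and> Lhalf_tendsto unit_lebesgue (\<lambda>k x. b (node k x)) g"
    by blast
  from someI_ex[OF this] show integrable: "integrable unit_lebesgue (martingale_limit b)"
    and limit: "Lhalf_tendsto unit_lebesgue (\<lambda>k x. b (node k x)) (martingale_limit b)"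
    unfolding martingale_limit_def[symmetric] by blast+
  have "AE x in unit_lebesgue. martingale_limit b x = g x"
    by (rule unit.Lhalf_tendsto_unique[OF _ integrable g(1) limit g(3)]) simp
  then have "(LINT x|unit_lebesgue. \<bar>martingale_limit b x\<bar>) = (LINT x|unit_lebesgue. \<bar>g x\<bar>)"
    using integrable g(1) by (intro integral_cong_AE) (auto elim: eventually_mono)
  then show "(LINT x|unit_lebesgue. \<bar>martingale_limit b x\<bar>) \<le> B" using g(2) by simp
qed

lemma AE_martingale_limit_eqI:
  assumes "dyadic_martingale b" "level_bounded B b"
    and "integrable unit_lebesgue g" "Lhalf_tendsto unit_lebesgue (\<lambda>k x. b (node k x)) g"
  shows "AE x in unit_lebesgue. martingale_limit b x = g x"
  using assms by (intro unit.Lhalf_tendsto_unique[of "\<lambda>k x. b (node k x)"])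
    (auto intro: integrable_martingale_limit Lhalf_tendsto_martingale_limit)

lemma martingale_limit_linear:
  assumes "dyadic_martingale a" "level_bounded A a" "dyadic_martingale b" "level_bounded B b"
  shows "AE x in unit_lebesgue. martingale_limit (\<lambda>n. \<alpha> * a n + \<beta> * b n) x
    = \<alpha> * martingale_limit a x + \<beta> * martingale_limit b x"
proof (rule AE_martingale_limit_eqI)
  show "dyadic_martingale (\<lambda>n. \<alpha> * a n + \<beta> * b n)"
    by (intro dyadic_martingale_linear assms)
  show "level_bounded (\<bar>\<alpha>\<bar> * A + \<bar>\<beta>\<bar> * B) (\<lambda>n. \<alpha> * a n + \<beta> * b n)"
    by (intro level_bounded_linear assms)
  show "integrable unit_lebesgue (\<lambda>x. \<alpha> * martingale_limit a x + \<beta> * martingale_limit b x)"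
    by (intro Bochner_Integration.integrable_add integrable_mult_right
        integrable_martingale_limit[OF assms(1,2)] integrable_martingale_limit[OF assms(3,4)])
  show "Lhalf_tendsto unit_lebesgue (\<lambda>k x. \<alpha> * a (node k x) + \<beta> * b (node k x))
     (\<lambda>x. \<alpha> * martingale_limit a x + \<beta> * martingale_limit b x)"
    using assms by (intro unit.Lhalf_tendsto_linear integrable_martingale_limit
        Lhalf_tendsto_martingale_limit integrable_node)
qed

lemma level_bounded_cell_average:
  assumes f: "integrable unit_lebesgue f"
  shows "level_bounded (LINT x|unit_lebesgue. \<bar>f x\<bar>) (cell_average f)"
  unfolding level_bounded_def
proof
  fix k
  have "level_mean k (\<lambda>n. \<bar>cell_average f n\<bar>) \<le> level_mean k (cell_average (\<lambda>x. \<bar>f x\<bar>))"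
    by (intro level_mean_mono abs_cell_average_le)
  also have "\<dots> = (LINT x|unit_lebesgue. \<bar>f x\<bar>)"
    using integral_node_mult[of "\<lambda>x. \<bar>f x\<bar>" "\<lambda>n. 1" k] f by simp
  finally show "level_mean k (\<lambda>n. \<bar>cell_average f n\<bar>) \<le> (LINT x|unit_lebesgue. \<bar>f x\<bar>)" .
qed

lemma abs_cell_average_diff_le:
  assumes f: "integrable unit_lebesgue f" and near: "\<And>x. x \<in> dyadic_cell n \<Longrightarrow> \<bar>f x - c\<bar> \<le> e"
  shows "\<bar>cell_average f n - c\<bar> \<le> e"
proof -
  have "f x \<le> c + e" "c - e \<le> f x" if "x \<in> dyadic_cell n" for x
    using near[OF that] by linarith+
  then have "cell_average f n \<le> cell_average (\<lambda>x. c + e) n"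
    "cell_average (\<lambda>x. c - e) n \<le> cell_average f n"
    using f by (intro cell_average_mono; simp)+
  then show ?thesis by (simp add: abs_le_iff)
qed

lemma L1_tendsto_cell_average_continuous:
  assumes f: "continuous_on UNIV f" "integrable unit_lebesgue f"
  shows "(\<lambda>k. LINT x|unit_lebesgue. \<bar>cell_average f (node k x) - f x\<bar>) \<longlonglongrightarrow> 0"
proof (rule LIMSEQ_I)
  fix e :: real assume "0 < e"
  have "uniformly_continuous_on {0..1} f"
    using f(1) by (intro compact_uniformly_continuous) (auto intro: continuous_on_subset)
  then obtain d where "0 < d"
    and uniform: "\<And>x y. x \<in> {0..1} \<Longrightarrow> y \<in> {0..1} \<Longrightarrow> \<bar>y - x\<bar> < d \<Longrightarrow> \<bar>f y - f x\<bar> < e / 2"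
    unfolding uniformly_continuous_on_def dist_real_def using half_gt_zero[OF \<open>0 < e\<close>] by metis
  obtain N where mesh: "(1 / 2) ^ N < d"
    using real_arch_pow_inv[OF \<open>0 < d\<close>, of "1/2"] by auto
  have "\<bar>cell_average f (node k x) - f x\<bar> \<le> e / 2" if "N \<le> k" and x: "x \<in> {0..<1}" for k x
  proof (rule abs_cell_average_diff_le[OF f(2)])
    fix y assume "y \<in> dyadic_cell (node k x)"
    moreover have "x \<in> dyadic_cell (node k x)" "heap_level (node k x) = k"
      using node_eq_iff[OF x] by blast+
    ultimately have "\<bar>y - x\<bar> < (1 / 2) ^ k"
      by (auto simp: dyadic_cell_def add_divide_distrib power_one_over abs_less_iff)
    also have "\<dots> \<le> (1 / 2) ^ N" using \<open>N \<le> k\<close> by (intro power_decreasing) auto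
    also note mesh
    finally have "\<bar>y - x\<bar> < d" .
    moreover have "y \<in> {0..<1}" using \<open>y \<in> _\<close> dyadic_cell_subset by blast
    ultimately show "\<bar>f y - f x\<bar> \<le> e / 2" using uniform[of x y] x by (simp add: less_imp_le)
  qed
  then have "(LINT x|unit_lebesgue. \<bar>cell_average f (node k x) - f x\<bar>)
      \<le> (LINT x|unit_lebesgue. e / 2)"
    if "N \<le> k" for k
    using that f(2) by (intro integral_mono) auto
  then have "(LINT x|unit_lebesgue. \<bar>cell_average f (node k x) - f x\<bar>) \<le> e / 2" if "N \<le> k" for k
    using that by (simp add: measure_restrict_space)
  then show "\<exists>N. \<forall>k\<ge>N. norm ((LINT x|unit_lebesgue. \<bar>cell_average f (node k x) - f x\<bar>) - 0) < e"
    using \<open>0 < e\<close> by (force intro!: exI[of _ N])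
qed

lemma integral_abs_cell_average_diff_le:
  assumes f: "integrable unit_lebesgue f" and g: "integrable unit_lebesgue g"
  shows "(LINT x|unit_lebesgue. \<bar>cell_average f (node k x) - f x\<bar>)
    \<le> 2 * (LINT x|unit_lebesgue. \<bar>f x - g x\<bar>)
      + (LINT x|unit_lebesgue. \<bar>cell_average g (node k x) - g x\<bar>)"
proof -
  let ?h = "\<lambda>x. f x - g x"
  have h: "integrable unit_lebesgue ?h" using f g by simp
  have "cell_average ?h = (\<lambda>n. cell_average f n - cell_average g n)"
    using cell_average_linear[OF f g, of 1 "-1"] by simp
  then have "(LINT x|unit_lebesgue. \<bar>cell_average f (node k x) - f x\<bar>)
      \<le> (LINT x|unit_lebesgue. \<bar>cell_average ?h (node k x)\<bar> + \<bar>?h x\<bar>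
          + \<bar>cell_average g (node k x) - g x\<bar>)"
    using f g by (intro integral_mono) auto
  also have "\<dots> = (LINT x|unit_lebesgue. \<bar>cell_average ?h (node k x)\<bar>)
      + (LINT x|unit_lebesgue. \<bar>?h x\<bar>) + (LINT x|unit_lebesgue. \<bar>cell_average g (node k x) - g x\<bar>)"
    using f g h by simp
  also have "(LINT x|unit_lebesgue. \<bar>cell_average ?h (node k x)\<bar>) \<le> (LINT x|unit_lebesgue. \<bar>?h x\<bar>)"
    using level_bounded_cell_average[OF h] integral_node[of "\<lambda>n. \<bar>cell_average ?h n\<bar>" k]
    by (simp add: level_bounded_def)
  finally show ?thesis by simp
qed

lemma L1_tendsto_cell_average:
  assumes f: "integrable unit_lebesgue f"
  shows "(\<lambda>k. LINT x|unit_lebesgue. \<bar>cell_average f (node k x) - f x\<bar>) \<longlonglongrightarrow> 0"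
proof (rule LIMSEQ_I)
  fix e :: real assume "0 < e"
  then obtain g where g: "continuous_on UNIV g" "integrable unit_lebesgue g"
      "(LINT x|unit_lebesgue. \<bar>f x - g x\<bar>) < e / 4"
    using L1_approx_continuous[OF lmeasurable_unit f, of "e / 4"] by auto
  obtain N where small:
      "\<And>k. N \<le> k \<Longrightarrow> (LINT x|unit_lebesgue. \<bar>cell_average g (node k x) - g x\<bar>) < e / 2"
    using LIMSEQ_D[OF L1_tendsto_cell_average_continuous[OF g(1,2)] half_gt_zero[OF \<open>0 < e\<close>]]
    by auto
  have "(LINT x|unit_lebesgue. \<bar>cell_average f (node k x) - f x\<bar>) < e" if "N \<le> k" for k
    using integral_abs_cell_average_diff_le[OF f g(2), of k] g(3) small[OF that] by linarith
  then show "\<exists>N. \<forall>k\<ge>N. norm ((LINT x|unit_lebesgue. \<bar>cell_average f (node k x) - f x\<bar>) - 0) < e"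
    by auto
qed

lemma martingale_limit_cell_average:
  assumes f: "integrable unit_lebesgue f"
  shows "AE x in unit_lebesgue. martingale_limit (cell_average f) x = f x"
proof (rule AE_martingale_limit_eqI)
  show "Lhalf_tendsto unit_lebesgue (\<lambda>k x. cell_average f (node k x)) f"
    using f by (intro unit.Lhalf_tendsto_if_L1_tendsto L1_tendsto_cell_average) auto
qed (use f in \<open>auto intro: dyadic_martingale_cell_average level_bounded_cell_average\<close>)

section \<open>The embedding and the projection\<close>

lemma ces_avg_le_norm: "a \<in> ces_inf \<Longrightarrow> ces_avg a n \<le> ces_norm a"
  unfolding ces_inf_def ces_norm_def by (auto intro: cSUP_upper)

lemma level_bounded_ces_norm:
  assumes "a \<in> ces_inf"
  shows "level_bounded (2 * ces_norm a) a"
  unfolding level_bounded_def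
proof
  fix k
  define N :: nat where "N = 2 ^ Suc k - 2"
  have Suc_N_le: "Suc N \<le> 2 * 2 ^ k"
    using zero_less_power[of "2::nat" k] unfolding N_def power_Suc by linarith
  have "(\<Sum>n | heap_level n = k. \<bar>a n\<bar>) \<le> (\<Sum>n\<le>N. \<bar>a n\<bar>)"
    by (rule sum_mono2) (auto simp: N_def heap_level_eq_iff)
  also have "\<dots> = real (Suc N) * ces_avg a N" by (simp add: ces_avg_def)
  also have "\<dots> \<le> real (2 * 2 ^ k) * ces_norm a"
  proof (rule mult_mono)
    show "real (Suc N) \<le> real (2 * 2 ^ k)" using Suc_N_le by (simp only: of_nat_le_iff)
    show "ces_avg a N \<le> ces_norm a" by (rule ces_avg_le_norm[OF assms])
  qed (auto simp: ces_avg_def)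
  finally show "level_mean k (\<lambda>n. \<bar>a n\<bar>) \<le> 2 * ces_norm a"
    by (simp add: level_mean_def divide_le_eq mult_ac)
qed

lemma ces_avg_le_level_bounded:
  assumes "level_bounded B a"
  shows "ces_avg a N \<le> 2 * B"
proof -
  define K where "K = heap_level N"
  have "2 ^ K \<le> Suc N" using heap_level_eq_iff[of N K] by (simp add: K_def)
  then have power_le: "(2::real) ^ K \<le> real (Suc N)"
    by (metis of_nat_le_iff of_nat_numeral of_nat_power)
  have level_sum_le: "(\<Sum>n | heap_level n = k. \<bar>a n\<bar>) \<le> 2 ^ k * B" for k
    using assms by (simp add: level_bounded_def level_mean_def divide_le_eq mult.commute)
  have "0 \<le> (\<Sum>n | heap_level n = 0. \<bar>a n\<bar>)" by (simp add: sum_nonneg)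
  also have "\<dots> \<le> B" using level_sum_le[of 0] by simp
  finally have "0 \<le> B" .
  have "heap_level n \<le> K" if "n \<le> N" for n
    using that by (simp add: K_def heap_level_def floor_log_le_iff)
  then have "(\<Sum>n\<le>N. \<bar>a n\<bar>) = (\<Sum>k\<le>K. \<Sum>n | n \<in> {..N} \<and> heap_level n = k. \<bar>a n\<bar>)"
    by (intro sum.group[symmetric]) auto
  also have "\<dots> \<le> (\<Sum>k\<le>K. \<Sum>n | heap_level n = k. \<bar>a n\<bar>)"
    by (intro sum_mono sum_mono2) auto
  also have "\<dots> \<le> (\<Sum>k\<le>K. 2 ^ k * B)" by (intro sum_mono level_sum_le)
  also have "\<dots> = (2 ^ Suc K - 1) * B"
    using sum_gp0[of "2::real" K] by (simp add: sum_distrib_right[symmetric])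
  also have "\<dots> \<le> (2 * real (Suc N)) * B"
    using power_le \<open>0 \<le> B\<close> by (intro mult_right_mono) auto
  finally show ?thesis
    by (simp add: ces_avg_def divide_le_eq mult_ac)
qed

lemma
  assumes "level_bounded B a"
  shows ces_inf_if_level_bounded: "a \<in> ces_inf"
    and ces_norm_le_if_level_bounded: "ces_norm a \<le> 2 * B"
  using ces_avg_le_level_bounded[OF assms]
  by (auto simp: ces_inf_def bdd_above_def ces_norm_def intro: cSUP_least)

text \<open>On each level a sequence is the density of a measure on \<open>[0,1]\<close>; \<open>dyadic_limit\<close> is the limit
  of these measures, and \<open>ces_density\<close> the density of its absolutely continuous part.\<close>

definition ces_density :: "(nat \<Rightarrow> real) \<Rightarrow> real \<Rightarrow> real" where
  "ces_density a = martingale_limit (dyadic_limit a)"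

lemma
  assumes "a \<in> ces_inf"
  shows integrable_ces_density: "integrable unit_lebesgue (ces_density a)"
    and integral_abs_ces_density_le: "(LINT x|unit_lebesgue. \<bar>ces_density a x\<bar>) \<le> 2 * ces_norm a"
proof -
  note bound = level_bounded_ces_norm[OF assms]
  note martingale = dyadic_martingale_dyadic_limit[OF bound] level_bounded_dyadic_limit[OF bound]
  show "integrable unit_lebesgue (ces_density a)"
    unfolding ces_density_def using martingale by (rule integrable_martingale_limit)
  show "(LINT x|unit_lebesgue. \<bar>ces_density a x\<bar>) \<le> 2 * ces_norm a"
    unfolding ces_density_def using martingale by (rule integral_abs_martingale_limit_le)
qed

lemma ces_density_linear:
  assumes "a \<in> ces_inf" "b \<in> ces_inf"
  shows "AE x in unit_lebesgue. ces_density (\<lambda>n. \<alpha> * a n + \<beta> * b n) x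
    = \<alpha> * ces_density a x + \<beta> * ces_density b x"
proof -
  note bounds = assms[THEN level_bounded_ces_norm]
  show ?thesis
    unfolding ces_density_def dyadic_limit_linear[OF bounds]
    using bounds
    by (intro martingale_limit_linear dyadic_martingale_dyadic_limit level_bounded_dyadic_limit)
qed

lemma ces_density_cell_average:
  assumes "integrable unit_lebesgue f"
  shows "AE x in unit_lebesgue. ces_density (cell_average f) x = f x"
  unfolding ces_density_def dyadic_limit_martingale[OF dyadic_martingale_cell_average[OF assms]]
  using assms by (rule martingale_limit_cell_average)

lemma ces_inf_linear:
  assumes "a \<in> ces_inf" "b \<in> ces_inf"
  shows "(\<lambda>n. \<alpha> * a n + \<beta> * b n) \<in> ces_inf"
  using level_bounded_linear[OF assms[THEN level_bounded_ces_norm]]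
  by (rule ces_inf_if_level_bounded)

lemma L1_01_iff: "f \<in> L1_01 \<longleftrightarrow> integrable unit_lebesgue f"
proof -
  have "set_integrable lebesgue {0..1} f \<longleftrightarrow> set_integrable lebesgue {0..<1} f"
    by (rule set_integrable_discrete_difference[where X = "{1}"]) auto
  then show ?thesis
    by (simp add: L1_01_def set_integrable_def integrable_restrict_space)
qed

lemma L1_norm_eq: "L1_norm f = (LINT x|unit_lebesgue. \<bar>f x\<bar>)"
proof -
  have "(LINT x:{0..1}|lebesgue. \<bar>f x\<bar>) = (LINT x:{0..<1}|lebesgue. \<bar>f x\<bar>)"
    by (rule set_integral_discrete_difference[where X = "{1}"]) auto
  then show ?thesis
    by (simp add: L1_norm_def set_lebesgue_integral_def integral_restrict_space)
qed

lemma
  assumes "f \<in> L1_01"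
  shows cell_average_in_ces_inf: "cell_average f \<in> ces_inf"
    and ces_norm_cell_average_le: "ces_norm (cell_average f) \<le> 2 * L1_norm f"
  using level_bounded_cell_average[of f] assms
  by (auto simp: L1_01_iff L1_norm_eq intro: ces_inf_if_level_bounded ces_norm_le_if_level_bounded)

lemma L1_norm_le_ces_norm_cell_average:
  assumes "f \<in> L1_01"
  shows "L1_norm f \<le> 2 * ces_norm (cell_average f)"
proof -
  note f = assms[unfolded L1_01_iff] and average = cell_average_in_ces_inf[OF assms]
  have "L1_norm f = (LINT x|unit_lebesgue. \<bar>ces_density (cell_average f) x\<bar>)"
    unfolding L1_norm_eq using ces_density_cell_average[OF f] integrable_ces_density[OF average] f
    by (intro integral_cong_AE) (auto elim: eventually_mono)
  also have "\<dots> \<le> 2 * ces_norm (cell_average f)"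
    using average by (rule integral_abs_ces_density_le)
  finally show ?thesis .
qed

definition ces_projection :: "(nat \<Rightarrow> real) \<Rightarrow> nat \<Rightarrow> real" where
  "ces_projection a = cell_average (ces_density a)"

lemma ces_density_in_L1_01: "a \<in> ces_inf \<Longrightarrow> ces_density a \<in> L1_01"
  by (simp add: L1_01_iff integrable_ces_density)

lemma ces_projection_linear:
  assumes "a \<in> ces_inf" "b \<in> ces_inf"
  shows "ces_projection (\<lambda>n. \<alpha> * a n + \<beta> * b n)
    = (\<lambda>n. \<alpha> * ces_projection a n + \<beta> * ces_projection b n)"
proof -
  have "ces_projection (\<lambda>n. \<alpha> * a n + \<beta> * b n)
      = cell_average (\<lambda>x. \<alpha> * ces_density a x + \<beta> * ces_density b x)"
    unfolding ces_projection_def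
    using assms
    by (intro cell_average_cong_AE ces_density_linear integrable_ces_density ces_inf_linear
        Bochner_Integration.integrable_add integrable_mult_right)
  then show ?thesis
    using assms by (simp add: cell_average_linear integrable_ces_density ces_projection_def)
qed

lemma ces_projection_cell_average:
  assumes "f \<in> L1_01"
  shows "ces_projection (cell_average f) = cell_average f"
  using assms cell_average_in_ces_inf[OF assms] unfolding L1_01_iff ces_projection_def
  by (intro cell_average_cong_AE ces_density_cell_average integrable_ces_density)

lemma ces_projection_in_ces_inf: "a \<in> ces_inf \<Longrightarrow> ces_projection a \<in> ces_inf"
  by (simp add: ces_projection_def cell_average_in_ces_inf ces_density_in_L1_01)

lemma ces_norm_projection_le:
  assumes "a \<in> ces_inf"
  shows "ces_norm (ces_projection a) \<le> 4 * ces_norm a"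
  using ces_norm_cell_average_le[OF ces_density_in_L1_01[OF assms]]
    integral_abs_ces_density_le[OF assms]
  by (simp add: ces_projection_def L1_norm_eq)

lemma ces_projection_idem: "a \<in> ces_inf \<Longrightarrow> ces_projection (ces_projection a) = ces_projection a"
  using ces_projection_cell_average[OF ces_density_in_L1_01] by (simp add: ces_projection_def)

lemma ces_projection_image: "ces_projection ` ces_inf = cell_average ` L1_01"
proof
  show "ces_projection ` ces_inf \<subseteq> cell_average ` L1_01"
    by (auto simp: ces_projection_def ces_density_in_L1_01)
  show "cell_average ` L1_01 \<subseteq> ces_projection ` ces_inf"
    using ces_projection_cell_average cell_average_in_ces_inf by (metis image_subsetI imageI)
qed

theorem theorem3:
  shows "\<exists>(T :: (real \<Rightarrow> real) \<Rightarrow> (nat \<Rightarrow> real)) (P :: (nat \<Rightarrow> real) \<Rightarrow> (nat \<Rightarrow> real)) c C K.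
     \<comment> \<open>T is a linear isomorphic embedding of L_1[0,1] into ces_infinity\<close>
     (\<forall>f\<in>L1_01. T f \<in> ces_inf) \<and>
     (\<forall>f\<in>L1_01. \<forall>g\<in>L1_01. T (\<lambda>x. f x + g x) = (\<lambda>n. T f n + T g n)) \<and>
     (\<forall>f\<in>L1_01. \<forall>r::real. T (\<lambda>x. r * f x) = (\<lambda>n. r * T f n)) \<and>
     0 < c \<and> 0 < C \<and>
     (\<forall>f\<in>L1_01. c * L1_norm f \<le> ces_norm (T f) \<and> ces_norm (T f) \<le> C * L1_norm f) \<and>
     \<comment> \<open>P is a bounded linear projection of ces_infinity onto the image T(L_1[0,1])\<close>
     (\<forall>a\<in>ces_inf. P a \<in> ces_inf) \<and>
     (\<forall>a\<in>ces_inf. \<forall>b\<in>ces_inf. P (\<lambda>n. a n + b n) = (\<lambda>n. P a n + P b n)) \<and>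
     (\<forall>a\<in>ces_inf. \<forall>r::real. P (\<lambda>n. r * a n) = (\<lambda>n. r * P a n)) \<and>
     (\<forall>a\<in>ces_inf. ces_norm (P a) \<le> K * ces_norm a) \<and>
     (\<forall>a\<in>ces_inf. P (P a) = P a) \<and>
     P ` ces_inf = T ` L1_01"
proof (rule exI[of _ cell_average], rule exI[of _ ces_projection], rule exI[of _ "1 / 2"],
    rule exI[of _ 2], rule exI[of _ 4], intro conjI ballI allI)
  show "cell_average (\<lambda>x. f x + g x) = (\<lambda>n. cell_average f n + cell_average g n)"
    if "f \<in> L1_01" "g \<in> L1_01" for f g
    using cell_average_linear[of f g 1 1] that by (simp add: L1_01_iff)
  show "cell_average (\<lambda>x. r * f x) = (\<lambda>n. r * cell_average f n)" if "f \<in> L1_01" for f r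
    using cell_average_linear[of f f r 0] that by (simp add: L1_01_iff)
  show "1 / 2 * L1_norm f \<le> ces_norm (cell_average f)" if "f \<in> L1_01" for f
    using L1_norm_le_ces_norm_cell_average[OF that] by simp
  show "ces_projection (\<lambda>n. a n + b n) = (\<lambda>n. ces_projection a n + ces_projection b n)"
    if "a \<in> ces_inf" "b \<in> ces_inf" for a b
    using ces_projection_linear[OF that, of 1 1] by simp
  show "ces_projection (\<lambda>n. r * a n) = (\<lambda>n. r * ces_projection a n)" if "a \<in> ces_inf" for a r
    using ces_projection_linear[OF that that, of r 0] by simp
qed (simp_all add: cell_average_in_ces_inf ces_norm_cell_average_le ces_projection_in_ces_inf
    ces_norm_projection_le ces_projection_idem ces_projection_image)

end
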